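(* Let $Q$ be a $*$-left Ehresmann monoid with proper basis $H$ and semilattice of projections $E$, and let $T=Q/\sigma$. Then there exist a semilattice $\mathcal{X}$ with identity, an order-preserving left action of $T$ on $\mathcal{X}$, and a subsemilattice $\mathcal{Y}\cong E$ of $\mathcal{X}$ with identity satisfying conditions (A) and (B), such that $Q$ is isomorphic, as a biunary monoid, to $\mathcal{Q}_\ell(T,\mathcal{X},\mathcal{Y})$, a biunary monoid subsemigroup of $\mathcal{P}_\ell(T,\mathcal{X})$.
   Context: A semilattice is a commutative semigroup of idempotents, ordered by $e\le f$ iff $ef=e$. A $*$-left Ehresmann monoid is a monoid $M$ with unary operations $+,*$ satisfying $x^+x=x$, $(x^+y^+)^+=x^+y^+$, $x^+y^+=y^+x^+$, $(xy)^+=(xy^+)^+$, $xx^*=x$, $(x^* )^*=x^*$, $x^*y^*=y^*x^*$, $(xy^* )^*y^*=(xy^* )^*$, $(x^* )^+=x^*$, $(x^+)^*=x^+$; $E=\{a^+\}=\{a^*\}$; $\sigma$ is the least monoid congruence containing $E\times E$. $H\subseteq M$ is atomic if: (H1) $E\subseteq H$; (H2) $h\in H,e\in E$ imply $he\in H$ and $(he)^*=h^*e$; (H3) if $h\in H$, $k\in H\setminus E$, $h^*\ge k^+$ then $hk\in H$ and $(hk)^*=k^*$; (H4) every $m$ is $\sigma$-related to some $h\in H$; (H5) if $h,k,w\in H$, $hk\,\sigma\,w$, $k^*=w^*$, then some $u\in H$ has $u\,\sigma\,h$, $u^*\ge k^+$. $H$ is proper if ($h^*=k^*$ and $h\,\sigma\,k$)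 iff $h=k$. $h_1\cdots h_n$ is in $H$-canonical form if $h_i^*<h_{i+1}^+$ ($1\le i<n$) and $h_i\notin E$ ($2\le i\le n$); $M$ has $H$-canonical forms if each element has exactly one such expression. A proper basis is a proper atomic generating set $H$ (as a semigroup) for which $M$ has $H$-canonical forms. $\mathcal{P}_\ell(T,X)$ for a monoid $T$ acting on the left of a semilattice $X$ with identity by order-preserving maps: let $T*X$ be the semigroup free product acting on $X$ (elements of $X$ act by multiplication), $\omega^+=\omega\cdot1_X$, $\sim$ the semigroup congruence generated by $\{(\alpha^+\alpha,\alpha)\}\cup\{(1_T,1_X)\}$, and $\mathcal{P}_\ell(T,X)=(T*X)/\sim$ with $[\alpha]^+=[\alpha^+]$; $X$ and $T$ are identified with their injective images. It is left Ehresmann with projections $X$ and unique $T$-normal forms $t_0e_1t_1\cdots e_nt_n$ ($n\ge0$, $e_i\in X\setminus\{1\}$, $t_1,\dots,t_{n-1}\in T\setminus\{1\}$, $e_i<(t_ie_{i+1}\cdots e_nt_n)^+$); $*$ is $a^*=e_n$ if $n\ge1$, $t_n=1$, else $a^*=1$. Conditions on a subsemilattice $Y$ of $X$ with identity: (A) for $t\in T$, $e,f\in Y$, $e\le f$, $t\cdot f\in Y$ implies $t\cdot e\in Y$; (B) for each $t\in T$ some $g\in Y$ has $t\cdot g\in Y$. $\mathcal{Q}_\ell(T,X,Y)$ is the subsemigroup of $\mathcal{P}_\ell(T,X)$ generated by $\{te:t\in T,e\in Y,t\cdot e\in Y\}$, with inherited $+,*$. A biunary monoid subsemigroup is a subsemigroup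 closed under $+$ and $*$ that is a monoid (possibly with a different identity). *)

theory Defs
  imports Main
begin

definition star_left_ehresmann ::
  "('q \<Rightarrow> 'q \<Rightarrow> 'q) \<Rightarrow> 'q \<Rightarrow> ('q \<Rightarrow> 'q) \<Rightarrow> ('q \<Rightarrow> 'q) \<Rightarrow> bool" where
  "star_left_ehresmann mult one pl st \<longleftrightarrow>
     (\<forall>x y z. mult (mult x y) z = mult x (mult y z)) \<and>
     (\<forall>x. mult one x = x \<and> mult x one = x) \<and>
     (\<forall>x. mult (pl x) x = x) \<and>
     (\<forall>x y. pl (mult (pl x) (pl y)) = mult (pl x) (pl y)) \<and>
     (\<forall>x y. mult (pl x) (pl y) = mult (pl y) (pl x)) \<and>
     (\<forall>x y. pl (mult x y) = pl (mult x (pl y))) \<and>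
     (\<forall>x. mult x (st x) = x) \<and>
     (\<forall>x. st (st x) = st x) \<and>
     (\<forall>x y. mult (st x) (st y) = mult (st y) (st x)) \<and>
     (\<forall>x y. mult (st (mult x (st y))) (st y) = st (mult x (st y))) \<and>
     (\<forall>x. pl (st x) = st x) \<and>
     (\<forall>x. st (pl x) = pl x) \<and>
     range pl = range st"

definition leE :: "('q \<Rightarrow> 'q \<Rightarrow> 'q) \<Rightarrow> 'q \<Rightarrow> 'q \<Rightarrow> bool" where
  "leE mult e f \<longleftrightarrow> mult e f = e"

definition ltE :: "('q \<Rightarrow> 'q \<Rightarrow> 'q) \<Rightarrow> 'q \<Rightarrow> 'q \<Rightarrow> bool" where
  "ltE mult e f \<longleftrightarrow> leE mult e f \<and> e \<noteq> f"

definition monoid_cong :: "('q \<Rightarrow> 'q \<Rightarrow> 'q) \<Rightarrow> ('q \<times> 'q) set \<Rightarrow> bool" where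
  "monoid_cong mult R \<longleftrightarrow> equiv UNIV R \<and>
     (\<forall>(a, b) \<in> R. \<forall>c. (mult c a, mult c b) \<in> R \<and> (mult a c, mult b c) \<in> R)"

definition sigmaQ :: "('q \<Rightarrow> 'q \<Rightarrow> 'q) \<Rightarrow> ('q \<Rightarrow> 'q) \<Rightarrow> ('q \<times> 'q) set" where
  "sigmaQ mult pl = \<Inter> {R. monoid_cong mult R \<and> range pl \<times> range pl \<subseteq> R}"

definition atomic ::
  "('q \<Rightarrow> 'q \<Rightarrow> 'q) \<Rightarrow> ('q \<Rightarrow> 'q) \<Rightarrow> ('q \<Rightarrow> 'q) \<Rightarrow> 'q set \<Rightarrow> bool" where
  "atomic mult pl st H \<longleftrightarrow>
     range pl \<subseteq> H \<and>
     (\<forall>h\<in>H. \<forall>e\<in>range pl. mult h e \<in> H \<and> st (mult h e) = mult (st h) e) \<and>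
     (\<forall>h\<in>H. \<forall>k\<in>H - range pl. leE mult (pl k) (st h) \<longrightarrow>
         mult h k \<in> H \<and> st (mult h k) = st k) \<and>
     (\<forall>m. \<exists>h\<in>H. (m, h) \<in> sigmaQ mult pl) \<and>
     (\<forall>h\<in>H. \<forall>k\<in>H. \<forall>w\<in>H. (mult h k, w) \<in> sigmaQ mult pl \<and> st k = st w \<longrightarrow>
         (\<exists>u\<in>H. (u, h) \<in> sigmaQ mult pl \<and> leE mult (pl k) (st u)))"

definition proper_set ::
  "('q \<Rightarrow> 'q \<Rightarrow> 'q) \<Rightarrow> ('q \<Rightarrow> 'q) \<Rightarrow> ('q \<Rightarrow> 'q) \<Rightarrow> 'q set \<Rightarrow> bool" where
  "proper_set mult pl st H \<longleftrightarrow>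
     (\<forall>h\<in>H. \<forall>k\<in>H. (st h = st k \<and> (h, k) \<in> sigmaQ mult pl) \<longleftrightarrow> h = k)"

primrec lprod :: "('q \<Rightarrow> 'q \<Rightarrow> 'q) \<Rightarrow> 'q \<Rightarrow> 'q list \<Rightarrow> 'q" where
  "lprod mult one [] = one"
| "lprod mult one (x # xs) = mult x (lprod mult one xs)"

definition generates_semigroup :: "('q \<Rightarrow> 'q \<Rightarrow> 'q) \<Rightarrow> 'q \<Rightarrow> 'q set \<Rightarrow> bool" where
  "generates_semigroup mult one H \<longleftrightarrow>
     (\<forall>q. \<exists>hs. hs \<noteq> [] \<and> set hs \<subseteq> H \<and> lprod mult one hs = q)"

definition canonical_form ::
  "('q \<Rightarrow> 'q \<Rightarrow> 'q) \<Rightarrow> ('q \<Rightarrow> 'q) \<Rightarrow> ('q \<Rightarrow> 'q) \<Rightarrow> 'q set \<Rightarrow> 'q list \<Rightarrow> bool" where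
  "canonical_form mult pl st H hs \<longleftrightarrow>
     hs \<noteq> [] \<and> set hs \<subseteq> H \<and>
     (\<forall>i. Suc i < length hs \<longrightarrow> ltE mult (st (hs ! i)) (pl (hs ! Suc i))) \<and>
     (\<forall>i. 0 < i \<and> i < length hs \<longrightarrow> hs ! i \<notin> range pl)"

definition has_canonical_forms ::
  "('q \<Rightarrow> 'q \<Rightarrow> 'q) \<Rightarrow> 'q \<Rightarrow> ('q \<Rightarrow> 'q) \<Rightarrow> ('q \<Rightarrow> 'q) \<Rightarrow> 'q set \<Rightarrow> bool" where
  "has_canonical_forms mult one pl st H \<longleftrightarrow>
     (\<forall>q. \<exists>!hs. canonical_form mult pl st H hs \<and> lprod mult one hs = q)"

definition proper_basis ::
  "('q \<Rightarrow> 'q \<Rightarrow> 'q) \<Rightarrow> 'q \<Rightarrow> ('q \<Rightarrow> 'q) \<Rightarrow> ('q \<Rightarrow> 'q) \<Rightarrow> 'q set \<Rightarrow> bool" where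
  "proper_basis mult one pl st H \<longleftrightarrow>
     atomic mult pl st H \<and> proper_set mult pl st H \<and>
     generates_semigroup mult one H \<and> has_canonical_forms mult one pl st H"

definition Tcar :: "('q \<Rightarrow> 'q \<Rightarrow> 'q) \<Rightarrow> ('q \<Rightarrow> 'q) \<Rightarrow> 'q set set" where
  "Tcar mult pl = UNIV // sigmaQ mult pl"

definition Tmult :: "('q \<Rightarrow> 'q \<Rightarrow> 'q) \<Rightarrow> ('q \<Rightarrow> 'q) \<Rightarrow> 'q set \<Rightarrow> 'q set \<Rightarrow> 'q set" where
  "Tmult mult pl A B = sigmaQ mult pl `` {mult (SOME a. a \<in> A) (SOME b. b \<in> B)}"

definition Tone :: "('q \<Rightarrow> 'q \<Rightarrow> 'q) \<Rightarrow> 'q \<Rightarrow> ('q \<Rightarrow> 'q) \<Rightarrow> 'q set" where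
  "Tone mult one pl = sigmaQ mult pl `` {one}"

definition semilattice_with_identity :: "'x set \<Rightarrow> ('x \<Rightarrow> 'x \<Rightarrow> 'x) \<Rightarrow> 'x \<Rightarrow> bool" where
  "semilattice_with_identity Xc meet oneX \<longleftrightarrow>
     oneX \<in> Xc \<and>
     (\<forall>x\<in>Xc. \<forall>y\<in>Xc. meet x y \<in> Xc) \<and>
     (\<forall>x\<in>Xc. \<forall>y\<in>Xc. \<forall>z\<in>Xc. meet (meet x y) z = meet x (meet y z)) \<and>
     (\<forall>x\<in>Xc. \<forall>y\<in>Xc. meet x y = meet y x) \<and>
     (\<forall>x\<in>Xc. meet x x = x) \<and>
     (\<forall>x\<in>Xc. meet oneX x = x)"

definition leX :: "('x \<Rightarrow> 'x \<Rightarrow> 'x) \<Rightarrow> 'x \<Rightarrow> 'x \<Rightarrow> bool" where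
  "leX meet x y \<longleftrightarrow> meet x y = x"

definition ltX :: "('x \<Rightarrow> 'x \<Rightarrow> 'x) \<Rightarrow> 'x \<Rightarrow> 'x \<Rightarrow> bool" where
  "ltX meet x y \<longleftrightarrow> leX meet x y \<and> x \<noteq> y"

definition order_preserving_left_action ::
  "'t set \<Rightarrow> ('t \<Rightarrow> 't \<Rightarrow> 't) \<Rightarrow> 't \<Rightarrow> 'x set \<Rightarrow> ('x \<Rightarrow> 'x \<Rightarrow> 'x) \<Rightarrow> ('t \<Rightarrow> 'x \<Rightarrow> 'x) \<Rightarrow> bool" where
  "order_preserving_left_action Tc tm t1 Xc meet act \<longleftrightarrow>
     (\<forall>t\<in>Tc. \<forall>x\<in>Xc. act t x \<in> Xc) \<and>
     (\<forall>x\<in>Xc. act t1 x = x) \<and>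
     (\<forall>s\<in>Tc. \<forall>t\<in>Tc. \<forall>x\<in>Xc. act (tm s t) x = act s (act t x)) \<and>
     (\<forall>t\<in>Tc. \<forall>x\<in>Xc. \<forall>y\<in>Xc. leX meet x y \<longrightarrow> leX meet (act t x) (act t y))"

text \<open>Y is a subsemilattice of X which has an identity (possibly different from that of X).\<close>
definition subsemilattice_with_identity :: "'x set \<Rightarrow> 'x set \<Rightarrow> ('x \<Rightarrow> 'x \<Rightarrow> 'x) \<Rightarrow> bool" where
  "subsemilattice_with_identity Yc Xc meet \<longleftrightarrow>
     Yc \<subseteq> Xc \<and> (\<forall>x\<in>Yc. \<forall>y\<in>Yc. meet x y \<in> Yc) \<and>
     (\<exists>u\<in>Yc. \<forall>y\<in>Yc. meet u y = y)"

definition condA :: "'t set \<Rightarrow> 'x set \<Rightarrow> ('x \<Rightarrow> 'x \<Rightarrow> 'x) \<Rightarrow> ('t \<Rightarrow> 'x \<Rightarrow> 'x) \<Rightarrow> bool" where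
  "condA Tc Yc meet act \<longleftrightarrow>
     (\<forall>t\<in>Tc. \<forall>e\<in>Yc. \<forall>f\<in>Yc. leX meet e f \<and> act t f \<in> Yc \<longrightarrow> act t e \<in> Yc)"

definition condB :: "'t set \<Rightarrow> 'x set \<Rightarrow> ('t \<Rightarrow> 'x \<Rightarrow> 'x) \<Rightarrow> bool" where
  "condB Tc Yc act \<longleftrightarrow> (\<forall>t\<in>Tc. \<exists>g\<in>Yc. act t g \<in> Yc)"

text \<open>Elements of the free semigroup on the disjoint union of T and X (nonempty words);
  the semigroup free product T * X is its quotient by the relations of T and of X,
  which we add to the generating relations of the congruence.\<close>

primrec wact :: "('t \<Rightarrow> 'x \<Rightarrow> 'x) \<Rightarrow> ('x \<Rightarrow> 'x \<Rightarrow> 'x) \<Rightarrow> ('t + 'x) list \<Rightarrow> 'x \<Rightarrow> 'x" where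
  "wact act meet [] x = x"
| "wact act meet (l # w) x =
     (case l of Inl t \<Rightarrow> act t (wact act meet w x) | Inr e \<Rightarrow> meet e (wact act meet w x))"

definition Words :: "'t set \<Rightarrow> 'x set \<Rightarrow> ('t + 'x) list set" where
  "Words Tc Xc = {w. w \<noteq> [] \<and> set w \<subseteq> Inl ` Tc \<union> Inr ` Xc}"

definition sg_cong :: "'a list set \<Rightarrow> ('a list \<times> 'a list) set \<Rightarrow> bool" where
  "sg_cong W C \<longleftrightarrow> C \<subseteq> W \<times> W \<and> equiv W C \<and>
     (\<forall>(u, v)\<in>C. \<forall>w\<in>W. (w @ u, w @ v) \<in> C \<and> (u @ w, v @ w) \<in> C)"

definition Pl_base ::
  "'t set \<Rightarrow> ('t \<Rightarrow> 't \<Rightarrow> 't) \<Rightarrow> 't \<Rightarrow> 'x set \<Rightarrow> ('x \<Rightarrow> 'x \<Rightarrow> 'x) \<Rightarrow> 'x \<Rightarrow> ('t \<Rightarrow> 'x \<Rightarrow> 'x)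
   \<Rightarrow> (('t + 'x) list \<times> ('t + 'x) list) set" where
  "Pl_base Tc tm t1 Xc meet oneX act =
     {([Inl s, Inl t], [Inl (tm s t)]) | s t. s \<in> Tc \<and> t \<in> Tc} \<union>
     {([Inr e, Inr f], [Inr (meet e f)]) | e f. e \<in> Xc \<and> f \<in> Xc} \<union>
     {(Inr (wact act meet a oneX) # a, a) | a. a \<in> Words Tc Xc} \<union>
     {([Inl t1], [Inr oneX])}"

definition Pl_rel ::
  "'t set \<Rightarrow> ('t \<Rightarrow> 't \<Rightarrow> 't) \<Rightarrow> 't \<Rightarrow> 'x set \<Rightarrow> ('x \<Rightarrow> 'x \<Rightarrow> 'x) \<Rightarrow> 'x \<Rightarrow> ('t \<Rightarrow> 'x \<Rightarrow> 'x)
   \<Rightarrow> (('t + 'x) list \<times> ('t + 'x) list) set" where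
  "Pl_rel Tc tm t1 Xc meet oneX act =
     \<Inter> {C. sg_cong (Words Tc Xc) C \<and> Pl_base Tc tm t1 Xc meet oneX act \<subseteq> C}"

definition Pl_car ::
  "'t set \<Rightarrow> ('t \<Rightarrow> 't \<Rightarrow> 't) \<Rightarrow> 't \<Rightarrow> 'x set \<Rightarrow> ('x \<Rightarrow> 'x \<Rightarrow> 'x) \<Rightarrow> 'x \<Rightarrow> ('t \<Rightarrow> 'x \<Rightarrow> 'x)
   \<Rightarrow> ('t + 'x) list set set" where
  "Pl_car Tc tm t1 Xc meet oneX act = Words Tc Xc // Pl_rel Tc tm t1 Xc meet oneX act"

definition Pl_mult ::
  "'t set \<Rightarrow> ('t \<Rightarrow> 't \<Rightarrow> 't) \<Rightarrow> 't \<Rightarrow> 'x set \<Rightarrow> ('x \<Rightarrow> 'x \<Rightarrow> 'x) \<Rightarrow> 'x \<Rightarrow> ('t \<Rightarrow> 'x \<Rightarrow> 'x)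
   \<Rightarrow> ('t + 'x) list set \<Rightarrow> ('t + 'x) list set \<Rightarrow> ('t + 'x) list set" where
  "Pl_mult Tc tm t1 Xc meet oneX act A B =
     Pl_rel Tc tm t1 Xc meet oneX act `` {(SOME a. a \<in> A) @ (SOME b. b \<in> B)}"

definition Pl_plus ::
  "'t set \<Rightarrow> ('t \<Rightarrow> 't \<Rightarrow> 't) \<Rightarrow> 't \<Rightarrow> 'x set \<Rightarrow> ('x \<Rightarrow> 'x \<Rightarrow> 'x) \<Rightarrow> 'x \<Rightarrow> ('t \<Rightarrow> 'x \<Rightarrow> 'x)
   \<Rightarrow> ('t + 'x) list set \<Rightarrow> ('t + 'x) list set" where
  "Pl_plus Tc tm t1 Xc meet oneX act A =
     Pl_rel Tc tm t1 Xc meet oneX act `` {[Inr (wact act meet (SOME a. a \<in> A) oneX)]}"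

text \<open>T-normal form words t0 e1 t1 ... en tn: odd length, T-letters at even positions,
  X-letters at odd positions with e_i \<noteq> 1 and e_i < (t_i e_(i+1) ... e_n t_n)^+,
  and the inner T-letters t_1 ... t_(n-1) different from 1.\<close>
definition T_normal_form ::
  "'t set \<Rightarrow> 't \<Rightarrow> 'x set \<Rightarrow> ('x \<Rightarrow> 'x \<Rightarrow> 'x) \<Rightarrow> 'x \<Rightarrow> ('t \<Rightarrow> 'x \<Rightarrow> 'x)
   \<Rightarrow> ('t + 'x) list \<Rightarrow> bool" where
  "T_normal_form Tc t1 Xc meet oneX act w \<longleftrightarrow>
     odd (length w) \<and>
     (\<forall>j<length w. even j \<longrightarrow> (\<exists>t\<in>Tc. w ! j = Inl t)) \<and>
     (\<forall>j<length w. odd j \<longrightarrow> (\<exists>e\<in>Xc. w ! j = Inr e \<and> e \<noteq> oneX \<and>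
         ltX meet e (wact act meet (drop (Suc j) w) oneX))) \<and>
     (\<forall>j. 0 < j \<and> Suc j < length w \<and> even j \<longrightarrow> w ! j \<noteq> Inl t1)"

text \<open>a^* = e_n if n \<ge> 1 and t_n = 1, and a^* = 1 otherwise (computed from the normal form).\<close>
definition Pl_star ::
  "'t set \<Rightarrow> ('t \<Rightarrow> 't \<Rightarrow> 't) \<Rightarrow> 't \<Rightarrow> 'x set \<Rightarrow> ('x \<Rightarrow> 'x \<Rightarrow> 'x) \<Rightarrow> 'x \<Rightarrow> ('t \<Rightarrow> 'x \<Rightarrow> 'x)
   \<Rightarrow> ('t + 'x) list set \<Rightarrow> ('t + 'x) list set" where
  "Pl_star Tc tm t1 Xc meet oneX act A =
     (let w = (SOME w. w \<in> A \<and> T_normal_form Tc t1 Xc meet oneX act w) in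
      if 3 \<le> length w \<and> last w = Inl t1
      then Pl_rel Tc tm t1 Xc meet oneX act `` {[w ! (length w - 2)]}
      else Pl_rel Tc tm t1 Xc meet oneX act `` {[Inr oneX]})"

definition Ql_car ::
  "'t set \<Rightarrow> ('t \<Rightarrow> 't \<Rightarrow> 't) \<Rightarrow> 't \<Rightarrow> 'x set \<Rightarrow> ('x \<Rightarrow> 'x \<Rightarrow> 'x) \<Rightarrow> 'x \<Rightarrow> ('t \<Rightarrow> 'x \<Rightarrow> 'x)
   \<Rightarrow> 'x set \<Rightarrow> ('t + 'x) list set set" where
  "Ql_car Tc tm t1 Xc meet oneX act Yc =
     {Pl_rel Tc tm t1 Xc meet oneX act `` {concat ws} | ws.
        ws \<noteq> [] \<and> (\<forall>w\<in>set ws. \<exists>t\<in>Tc. \<exists>e\<in>Yc. act t e \<in> Yc \<and> w = [Inl t, Inr e])}"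

definition biunary_monoid_subsemigroup ::
  "'p set \<Rightarrow> 'p set \<Rightarrow> ('p \<Rightarrow> 'p \<Rightarrow> 'p) \<Rightarrow> ('p \<Rightarrow> 'p) \<Rightarrow> ('p \<Rightarrow> 'p) \<Rightarrow> bool" where
  "biunary_monoid_subsemigroup S P pm pp ps \<longleftrightarrow>
     S \<subseteq> P \<and> (\<forall>a\<in>S. \<forall>b\<in>S. pm a b \<in> S) \<and> (\<forall>a\<in>S. pp a \<in> S \<and> ps a \<in> S) \<and>
     (\<exists>u\<in>S. \<forall>a\<in>S. pm u a = a \<and> pm a u = a)"

definition biunary_monoid_iso ::
  "('q \<Rightarrow> 'q \<Rightarrow> 'q) \<Rightarrow> 'q \<Rightarrow> ('q \<Rightarrow> 'q) \<Rightarrow> ('q \<Rightarrow> 'q) \<Rightarrow>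
   'p set \<Rightarrow> ('p \<Rightarrow> 'p \<Rightarrow> 'p) \<Rightarrow> ('p \<Rightarrow> 'p) \<Rightarrow> ('p \<Rightarrow> 'p) \<Rightarrow> ('q \<Rightarrow> 'p) \<Rightarrow> bool" where
  "biunary_monoid_iso mult one pl st S pm pp ps \<phi> \<longleftrightarrow>
     bij_betw \<phi> UNIV S \<and>
     (\<forall>a b. \<phi> (mult a b) = pm (\<phi> a) (\<phi> b)) \<and>
     (\<forall>a. \<phi> (pl a) = pp (\<phi> a) \<and> \<phi> (st a) = ps (\<phi> a)) \<and>
     (\<forall>a\<in>S. pm (\<phi> one) a = a \<and> pm a (\<phi> one) = a)"

end

theory Submission
  imports Defs
begin

text \<open>
  The words over \<open>T\<close> and \<open>X\<close> act from the left on the set of \<open>T\<close>-normal forms, and this action respects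
  the defining relations of \<open>\<P>\<^sub>\<ell>(T, X)\<close>; hence two words are equal in \<open>\<P>\<^sub>\<ell>(T, X)\<close> iff they send the
  empty normal form to the same normal form.

  By properness an element \<open>h\<close> of \<open>H\<close> is determined by its \<open>\<sigma>\<close>-class \<open>[h]\<close> and \<open>h\<^sup>*\<close>, so
  \<open>[h] \<cdot> h\<^sup>* = h\<^sup>+\<close> defines a partial action of \<open>T = Q/\<sigma>\<close> on \<open>E\<close>; the axioms (H2)--(H5) say that its domains
  are ideals, that it preserves the order, and that \<open>t \<cdot> (s \<cdot> e)\<close> is defined iff \<open>(ts) \<cdot> e\<close> is, whenever
  \<open>s \<cdot> e\<close> is. Such a partial action embeds in an action on a semilattice of down-closed subsets of \<open>T \<times> E\<close>.
  Sending \<open>h \<in> H\<close> to \<open>[h] h\<^sup>*\<close> turns canonical forms into normal forms, compatibly with left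
  multiplication by elements of \<open>H\<close>, which yields the isomorphism.
\<close>

section \<open>Normal forms in the monoid of a semilattice action\<close>

locale monoid_acting_on_semilattice =
  fixes Tc :: "'t set" and tm :: "'t \<Rightarrow> 't \<Rightarrow> 't" and t1 :: 't
    and Xc :: "'x set" and meet :: "'x \<Rightarrow> 'x \<Rightarrow> 'x" and oneX :: 'x
    and act :: "'t \<Rightarrow> 'x \<Rightarrow> 'x"
  assumes tm_closed: "s \<in> Tc \<Longrightarrow> t \<in> Tc \<Longrightarrow> tm s t \<in> Tc"
    and t1_in: "t1 \<in> Tc"
    and tm_assoc: "r \<in> Tc \<Longrightarrow> s \<in> Tc \<Longrightarrow> t \<in> Tc \<Longrightarrow> tm (tm r s) t = tm r (tm s t)"
    and t1_left: "t \<in> Tc \<Longrightarrow> tm t1 t = t"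
    and t1_right: "t \<in> Tc \<Longrightarrow> tm t t1 = t"
    and semilattice: "semilattice_with_identity Xc meet oneX"
    and action: "order_preserving_left_action Tc tm t1 Xc meet act"
begin

lemma meet_closed: "x \<in> Xc \<Longrightarrow> y \<in> Xc \<Longrightarrow> meet x y \<in> Xc"
  and one_in: "oneX \<in> Xc"
  and meet_assoc: "x \<in> Xc \<Longrightarrow> y \<in> Xc \<Longrightarrow> z \<in> Xc \<Longrightarrow> meet (meet x y) z = meet x (meet y z)"
  and meet_comm: "x \<in> Xc \<Longrightarrow> y \<in> Xc \<Longrightarrow> meet x y = meet y x"
  and meet_idem: "x \<in> Xc \<Longrightarrow> meet x x = x"
  and meet_one: "x \<in> Xc \<Longrightarrow> meet oneX x = x"
  using semilattice unfolding semilattice_with_identity_def by blast+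

lemma act_closed: "t \<in> Tc \<Longrightarrow> x \<in> Xc \<Longrightarrow> act t x \<in> Xc"
  and act_one: "x \<in> Xc \<Longrightarrow> act t1 x = x"
  and act_act: "s \<in> Tc \<Longrightarrow> t \<in> Tc \<Longrightarrow> x \<in> Xc \<Longrightarrow> act (tm s t) x = act s (act t x)"
  and act_mono: "t \<in> Tc \<Longrightarrow> x \<in> Xc \<Longrightarrow> y \<in> Xc \<Longrightarrow> meet x y = x \<Longrightarrow> meet (act t x) (act t y) = act t x"
  using action unfolding order_preserving_left_action_def leX_def by blast+

lemma meet_one_right: "x \<in> Xc \<Longrightarrow> meet x oneX = x"
  using meet_comm meet_one one_in by metis

lemma meet_left_comm:
  "x \<in> Xc \<Longrightarrow> y \<in> Xc \<Longrightarrow> z \<in> Xc \<Longrightarrow> meet x (meet y z) = meet y (meet x z)"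
  using meet_assoc meet_comm by metis

lemma meet_left_idem: "x \<in> Xc \<Longrightarrow> y \<in> Xc \<Longrightarrow> meet x (meet x y) = meet x y"
  using meet_assoc meet_idem by metis

section \<open>Words, normal forms and the action of letters on normal forms\<close>

abbreviation letters :: "('t + 'x) set" where
  "letters \<equiv> Inl ` Tc \<union> Inr ` Xc"

abbreviation W :: "('t + 'x) list set" where
  "W \<equiv> Words Tc Xc"

abbreviation wa :: "('t + 'x) list \<Rightarrow> 'x \<Rightarrow> 'x" where
  "wa \<equiv> wact act meet"

definition rel :: "('t + 'x) list \<Rightarrow> ('t + 'x) list \<Rightarrow> bool" (infix "\<approx>" 50) where
  "u \<approx> v \<longleftrightarrow> (u, v) \<in> Pl_rel Tc tm t1 Xc meet oneX act"

lemma wact_closed: "set w \<subseteq> letters \<Longrightarrow> x \<in> Xc \<Longrightarrow> wa w x \<in> Xc"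
  by (induction w) (auto simp: act_closed meet_closed)

text \<open>Meeting with a fixed element is monotone, as is the action of \<open>Tc\<close>. With
  \<open>y = oneX\<close> this bounds every \<open>wa w x\<close> by
  \<open>wa w oneX\<close>.\<close>

lemma wact_mono:
  "set w \<subseteq> letters \<Longrightarrow> x \<in> Xc \<Longrightarrow> y \<in> Xc \<Longrightarrow> meet x y = x \<Longrightarrow> meet (wa w x) (wa w y) = wa w x"
proof (induction w)
  case (Cons l w)
  have w: "set w \<subseteq> letters" using Cons.prems by simp
  have IH: "meet (wa w x) (wa w y) = wa w x" using Cons by simp
  have cl: "wa w x \<in> Xc" "wa w y \<in> Xc" using w Cons.prems by (auto intro: wact_closed)
  show ?case
  proof (cases l)
    case (Inl t)
    then have "t \<in> Tc" using Cons.prems by auto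
    then show ?thesis using Inl IH cl act_mono by simp
  next
    case (Inr e)
    then have e: "e \<in> Xc" using Cons.prems by auto
    have "meet (meet e (wa w x)) (meet e (wa w y)) = meet e (meet (wa w x) (wa w y))"
      using e cl by (simp add: meet_assoc meet_left_comm meet_left_idem meet_closed)
    then show ?thesis using Inr IH by simp
  qed
qed simp

text \<open>A pair \<open>(t\<^sub>0, [(e\<^sub>1, t\<^sub>1), \<dots>, (e\<^sub>n, t\<^sub>n)])\<close> stands for the word \<open>t\<^sub>0 e\<^sub>1 t\<^sub>1 \<dots> e\<^sub>n t\<^sub>n\<close>;
  on normal forms, \<open>nf_val\<close> computes \<open>+\<close> because \<open>(e\<^sub>1 t\<^sub>1 \<dots> e\<^sub>n t\<^sub>n)\<^sup>+ = e\<^sub>1\<close>.\<close>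

fun nf_val :: "'t \<times> ('x \<times> 't) list \<Rightarrow> 'x" where
  "nf_val (t, []) = act t oneX"
| "nf_val (t, p # L) = act t (fst p)"

fun nf_tail :: "('x \<times> 't) list \<Rightarrow> bool" where
  "nf_tail [] \<longleftrightarrow> True"
| "nf_tail ((e, t) # L) \<longleftrightarrow> e \<in> Xc \<and> t \<in> Tc \<and> ltX meet e (nf_val (t, L)) \<and> (L \<noteq> [] \<longrightarrow> t \<noteq> t1) \<and> nf_tail L"

definition is_nf :: "'t \<times> ('x \<times> 't) list \<Rightarrow> bool" where
  "is_nf n \<longleftrightarrow> fst n \<in> Tc \<and> nf_tail (snd n)"

fun nf_word :: "'t \<times> ('x \<times> 't) list \<Rightarrow> ('t + 'x) list" where
  "nf_word (t, []) = [Inl t]"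
| "nf_word (t, (e, s) # L) = Inl t # Inr e # nf_word (s, L)"

text \<open>Left multiplication by one letter, renormalised. If \<open>v\<close> is the value of the
  normal form, a letter \<open>e\<close> acts like \<open>meet e v\<close>. If this is
  \<open>v\<close>, nothing changes; otherwise it is strictly below \<open>v\<close> and is put in
  front, after a new leading \<open>t1\<close>. If the old leading letter is \<open>t1\<close> and
  some \<open>e\<^sub>1\<close> follows, then \<open>v\<close> is \<open>e\<^sub>1\<close>, and
  \<open>meet e e\<^sub>1\<close> replaces it so that no inner \<open>t1\<close> arises.\<close>

fun lact :: "'t + 'x \<Rightarrow> 't \<times> ('x \<times> 't) list \<Rightarrow> 't \<times> ('x \<times> 't) list" where
  "lact (Inl s) (t, L) = (tm s t, L)"
| "lact (Inr e) (t, L) =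
    (if meet e (nf_val (t, L)) = nf_val (t, L) then (t, L)
     else if t = t1 \<and> L \<noteq> [] then (t1, (meet e (nf_val (t, L)), snd (hd L)) # tl L)
     else (t1, (meet e (nf_val (t, L)), t) # L))"

definition nf :: "('t + 'x) list \<Rightarrow> 't \<times> ('x \<times> 't) list" where
  "nf w = foldr lact w (t1, [])"

lemma nf_val_closed: "is_nf n \<Longrightarrow> nf_val n \<in> Xc"
  by (cases n rule: nf_val.cases) (auto simp: is_nf_def act_closed one_in split: prod.splits)

lemma is_nf_t1: "is_nf (t1, [])"
  by (simp add: is_nf_def t1_in)

lemma nf_val_lact:
  assumes "is_nf n" "l \<in> letters"
  shows "nf_val (lact l n) = wa [l] (nf_val n)"
proof -
  obtain t L where n: "n = (t, L)" by fastforce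
  have t: "t \<in> Tc" and v: "nf_val (t, L) \<in> Xc" using assms n nf_val_closed by (auto simp: is_nf_def)
  show ?thesis
  proof (cases l)
    case (Inl s)
    then have "s \<in> Tc" using assms by auto
    then show ?thesis using Inl n t assms
      by (cases L) (auto simp: act_act one_in is_nf_def)
  next
    case (Inr e)
    then have "e \<in> Xc" using assms by auto
    then show ?thesis using Inr n v by (auto simp: act_one meet_closed)
  qed
qed

lemma is_nf_lact:
  assumes "is_nf n" "l \<in> letters"
  shows "is_nf (lact l n)"
proof -
  obtain t L where n: "n = (t, L)" by fastforce
  have t: "t \<in> Tc" and v: "nf_val (t, L) \<in> Xc" and L: "nf_tail L"
    using assms n nf_val_closed by (auto simp: is_nf_def)
  show ?thesis
  proof (cases l)
    case (Inl s)
    then show ?thesis using assms n by (auto simp: is_nf_def tm_closed)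
  next
    case (Inr e)
    then have e: "e \<in> Xc" using assms by auto
    let ?v = "nf_val (t, L)"
    have le: "leX meet (meet e ?v) ?v"
      using e v by (simp add: leX_def meet_assoc meet_idem)
    have cl: "meet e ?v \<in> Xc" using e v by (simp add: meet_closed)
    show ?thesis
    proof (cases "meet e ?v = ?v")
      case True
      then show ?thesis using Inr n assms by simp
    next
      case ne: False
      show ?thesis
      proof (cases "t = t1 \<and> L \<noteq> []")
        case True
        then obtain e1 s L' where L': "L = (e1, s) # L'" by (metis list.exhaust surj_pair)
        then have e1: "e1 \<in> Xc" "s \<in> Tc" "ltX meet e1 (nf_val (s, L'))" "nf_tail L'"
          "L' \<noteq> [] \<longrightarrow> s \<noteq> t1"
          using L by auto
        have ve: "?v = e1" using True L' e1 by (simp add: act_one)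
        have vs: "nf_val (s, L') \<in> Xc" using e1 by (intro nf_val_closed) (simp add: is_nf_def)
        have "meet e1 (nf_val (s, L')) = e1" using e1 by (simp add: ltX_def leX_def)
        then have le': "meet (meet e e1) (nf_val (s, L')) = meet e e1"
          using e e1 vs by (simp add: meet_assoc)
        \<comment> \<open>Equality would put \<open>e1\<close> below \<open>meet e e1\<close>, so
          \<open>e\<close> would fix the value \<open>e1\<close>, which this case excludes.\<close>
        moreover have "meet e e1 \<noteq> nf_val (s, L')"
        proof
          assume "meet e e1 = nf_val (s, L')"
          then have "meet e1 (meet e e1) = e1" using e1 by (simp add: ltX_def leX_def)
          then have "meet e e1 = e1" using e e1(1) by (metis meet_assoc meet_comm meet_idem)
          then show False using ne ve by simp
        qed
        ultimately have "ltX meet (meet e e1) (nf_val (s, L'))" by (simp add: ltX_def leX_def)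
        then show ?thesis using ne Inr n True L' e1 e t1_in ve
          by (auto simp: is_nf_def meet_closed act_one)
      next
        case False
        then show ?thesis using ne Inr n L t cl le t1_in by (auto simp: is_nf_def ltX_def)
      qed
    qed
  qed
qed

lemma is_nf_foldr_lact: "is_nf n \<Longrightarrow> set w \<subseteq> letters \<Longrightarrow> is_nf (foldr lact w n)"
  by (induction w) (auto intro: is_nf_lact)

lemma nf_val_foldr_lact:
  "is_nf n \<Longrightarrow> set w \<subseteq> letters \<Longrightarrow> nf_val (foldr lact w n) = wa w (nf_val n)"
  by (induction w) (auto simp: nf_val_lact is_nf_foldr_lact split: sum.split)

lemma lact_Inl_Inl:
  assumes "is_nf n" "s \<in> Tc" "t \<in> Tc"
  shows "lact (Inl s) (lact (Inl t) n) = lact (Inl (tm s t)) n"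
  using assms by (cases n) (auto simp: is_nf_def tm_assoc)

lemma lact_Inr_absorb: "meet e (nf_val n) = nf_val n \<Longrightarrow> lact (Inr e) n = n"
  by (cases n) auto

lemma lact_Inr_cong: "meet e (nf_val n) = meet f (nf_val n) \<Longrightarrow> lact (Inr e) n = lact (Inr f) n"
  by (cases n) (simp only: lact.simps)

text \<open>If \<open>f\<close> changes the value of \<open>n\<close>, the result starts with
  \<open>t1\<close> and has a nonempty list, so \<open>e\<close> either fixes it or merges with its
  first element. Otherwise \<open>e\<close> and \<open>meet e f\<close> have the same meet with the
  value.\<close>

lemma lact_Inr_Inr:
  assumes "is_nf n" "e \<in> Xc" "f \<in> Xc"
  shows "lact (Inr e) (lact (Inr f) n) = lact (Inr (meet e f)) n"
proof -
  obtain t L where n: "n = (t, L)" by fastforce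
  let ?v = "nf_val (t, L)"
  have v: "?v \<in> Xc" using assms n nf_val_closed by auto
  show ?thesis
  proof (cases "meet f ?v = ?v")
    case True
    then have "lact (Inr f) n = n" using n by (intro lact_Inr_absorb) simp
    moreover have "lact (Inr e) n = lact (Inr (meet e f)) n"
      using True assms n v by (intro lact_Inr_cong) (simp only: meet_assoc)
    ultimately show ?thesis by simp
  next
    case False
    have ne: "meet (meet e f) ?v \<noteq> ?v"
    proof
      assume "meet (meet e f) ?v = ?v"
      then have "meet f ?v = meet f (meet e (meet f ?v))" using assms v by (simp add: meet_assoc)
      also have "\<dots> = meet (meet e f) ?v"
        using assms v by (simp add: meet_assoc meet_left_comm meet_left_idem meet_closed)
      finally show False using False \<open>meet (meet e f) ?v = ?v\<close> by simp
    qed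
    have eq: "meet e (meet f ?v) = meet (meet e f) ?v" using assms v by (simp add: meet_assoc)
    show ?thesis
      using False ne assms n v eq
      by (auto simp: act_one meet_closed)
  qed
qed

section \<open>Soundness: the defining relations respect the action on normal forms\<close>

definition same_action :: "(('t + 'x) list \<times> ('t + 'x) list) set" where
  "same_action = {(u, v) \<in> W \<times> W. \<forall>n. is_nf n \<longrightarrow> foldr lact u n = foldr lact v n}"

lemma Words_append: "u \<in> W \<Longrightarrow> v \<in> W \<Longrightarrow> u @ v \<in> W"
  by (auto simp: Words_def)

lemma sg_cong_same_action: "sg_cong W same_action"
  unfolding sg_cong_def
proof (intro conjI)
  show "same_action \<subseteq> W \<times> W" by (auto simp: same_action_def)
  show "equiv W same_action"
    by (rule equivI) (auto simp: same_action_def refl_on_def sym_def trans_def)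
  have "is_nf (foldr lact w n)" if "is_nf n" "w \<in> W" for w n
    using that is_nf_foldr_lact by (simp add: Words_def)
  then have "(w @ u, w @ v) \<in> same_action \<and> (u @ w, v @ w) \<in> same_action"
    if "(u, v) \<in> same_action" "w \<in> W" for u v w
    using that unfolding same_action_def
    by (simp add: Words_append del: split_paired_All)
  then show "\<forall>(u, v)\<in>same_action. \<forall>w\<in>W. (w @ u, w @ v) \<in> same_action \<and> (u @ w, v @ w) \<in> same_action"
    by blast
qed

text \<open>For the relation prefixing \<open>a\<close> with its projection: the value of
  \<open>foldr lact a n\<close> is \<open>wa a (nf_val n)\<close>, which lies below
  \<open>wa a oneX\<close>, so the extra letter is absorbed.\<close>

lemma Pl_base_same_action: "Pl_base Tc tm t1 Xc meet oneX act \<subseteq> same_action"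
proof -
  have "(Inr (wa a oneX) # a, a) \<in> same_action" if a: "a \<in> W" for a
  proof -
    have l: "set a \<subseteq> letters" using a by (simp add: Words_def)
    have "lact (Inr (wa a oneX)) (foldr lact a n) = foldr lact a n" if n: "is_nf n" for n
    proof (rule lact_Inr_absorb)
      have v: "nf_val n \<in> Xc" using n by (rule nf_val_closed)
      have "meet (wa a (nf_val n)) (wa a oneX) = wa a (nf_val n)"
        using v l by (intro wact_mono) (auto simp: one_in meet_one_right)
      then show "meet (wa a oneX) (nf_val (foldr lact a n)) = nf_val (foldr lact a n)"
        using n l v by (simp add: nf_val_foldr_lact meet_comm wact_closed one_in)
    qed
    moreover have "Inr (wa a oneX) # a \<in> W"
      using l by (auto simp: Words_def wact_closed one_in)
    ultimately show ?thesis using a by (simp add: same_action_def)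
  qed
  moreover have "([Inl s, Inl t], [Inl (tm s t)]) \<in> same_action" if "s \<in> Tc" "t \<in> Tc" for s t
    using that lact_Inl_Inl by (simp add: same_action_def Words_def tm_closed del: split_paired_All)
  moreover have "([Inr e, Inr f], [Inr (meet e f)]) \<in> same_action" if "e \<in> Xc" "f \<in> Xc" for e f
    using that lact_Inr_Inr by (simp add: same_action_def Words_def meet_closed del: split_paired_All)
  moreover have "([Inl t1], [Inr oneX]) \<in> same_action"
  proof -
    have "lact (Inl t1) n = lact (Inr oneX) n" if n: "is_nf n" for n
      using n nf_val_closed[OF n] by (cases n) (auto simp: t1_left is_nf_def meet_one)
    then show ?thesis by (simp add: same_action_def Words_def t1_in one_in del: split_paired_All)
  qed
  ultimately show ?thesis
    unfolding Pl_base_def by blast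
qed

text \<open>\<open>Pl_rel\<close> is the least congruence containing the defining relations, and
  \<open>same_action\<close> is one such congruence.\<close>

lemma rel_foldr_lact: "u \<approx> v \<Longrightarrow> is_nf n \<Longrightarrow> foldr lact u n = foldr lact v n"
  using sg_cong_same_action Pl_base_same_action unfolding rel_def Pl_rel_def same_action_def by blast

lemma rel_nf: "u \<approx> v \<Longrightarrow> nf u = nf v"
  unfolding nf_def by (rule rel_foldr_lact[OF _ is_nf_t1])

lemma rel_Words: "u \<approx> v \<Longrightarrow> u \<in> W \<and> v \<in> W"
  using sg_cong_same_action Pl_base_same_action unfolding rel_def Pl_rel_def same_action_def by blast

lemma rel_base: "(u, v) \<in> Pl_base Tc tm t1 Xc meet oneX act \<Longrightarrow> u \<approx> v"
  unfolding rel_def Pl_rel_def by blast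

lemma rel_refl: "u \<in> W \<Longrightarrow> u \<approx> u"
  unfolding rel_def Pl_rel_def sg_cong_def equiv_def refl_on_def by blast

lemma rel_sym:
  assumes "u \<approx> v"
  shows "v \<approx> u"
  unfolding rel_def Pl_rel_def
proof (rule InterI)
  fix C assume C: "C \<in> {C. sg_cong W C \<and> Pl_base Tc tm t1 Xc meet oneX act \<subseteq> C}"
  then have "(u, v) \<in> C" using assms by (auto simp: rel_def Pl_rel_def)
  moreover have "sym C" using C by (simp add: sg_cong_def equiv_def)
  ultimately show "(v, u) \<in> C" by (rule symD[rotated])
qed

lemma rel_trans [trans]:
  assumes "u \<approx> v" "v \<approx> w"
  shows "u \<approx> w"
  unfolding rel_def Pl_rel_def
proof (rule InterI)
  fix C assume C: "C \<in> {C. sg_cong W C \<and> Pl_base Tc tm t1 Xc meet oneX act \<subseteq> C}"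
  then have "(u, v) \<in> C" "(v, w) \<in> C" using assms by (auto simp: rel_def Pl_rel_def)
  moreover have "trans C" using C by (simp add: sg_cong_def equiv_def)
  ultimately show "(u, w) \<in> C" by (rule transD[rotated])
qed

lemma equiv_rel: "equiv W (Pl_rel Tc tm t1 Xc meet oneX act)"
proof (rule equivI)
  show "Pl_rel Tc tm t1 Xc meet oneX act \<subseteq> W \<times> W"
    using rel_Words by (auto simp: rel_def)
  show "refl_on W (Pl_rel Tc tm t1 Xc meet oneX act)"
    using rel_refl by (auto simp: refl_on_def rel_def)
  show "sym (Pl_rel Tc tm t1 Xc meet oneX act)"
    using rel_sym by (auto simp: sym_def rel_def)
  show "trans (Pl_rel Tc tm t1 Xc meet oneX act)"
    by (rule transI) (use rel_trans in \<open>unfold rel_def\<close>)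
qed

lemma rel_append_left: "u \<approx> v \<Longrightarrow> w \<in> W \<Longrightarrow> w @ u \<approx> w @ v"
  and rel_append_right: "u \<approx> v \<Longrightarrow> w \<in> W \<Longrightarrow> u @ w \<approx> v @ w"
  unfolding rel_def Pl_rel_def sg_cong_def by blast+

lemma rel_Cons: "u \<approx> v \<Longrightarrow> l \<in> letters \<Longrightarrow> l # u \<approx> l # v"
  using rel_append_left[of u v "[l]"] by (simp add: Words_def)

lemma rel_append: "u \<approx> v \<Longrightarrow> set w \<subseteq> letters \<Longrightarrow> u @ w \<approx> v @ w"
  using rel_append_right[of u v w] by (cases "w = []") (auto simp: Words_def)

lemma rel_Inl_Inl: "s \<in> Tc \<Longrightarrow> t \<in> Tc \<Longrightarrow> set w \<subseteq> letters \<Longrightarrow> Inl s # Inl t # w \<approx> Inl (tm s t) # w"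
  using rel_append[OF rel_base, of "[Inl s, Inl t]" "[Inl (tm s t)]" w] by (auto simp: Pl_base_def)

lemma rel_Inr_Inr: "e \<in> Xc \<Longrightarrow> f \<in> Xc \<Longrightarrow> set w \<subseteq> letters \<Longrightarrow> Inr e # Inr f # w \<approx> Inr (meet e f) # w"
  using rel_append[OF rel_base, of "[Inr e, Inr f]" "[Inr (meet e f)]" w] by (auto simp: Pl_base_def)

lemma rel_t1_one: "set w \<subseteq> letters \<Longrightarrow> Inl t1 # w \<approx> Inr oneX # w"
  using rel_append[OF rel_base, of "[Inl t1]" "[Inr oneX]" w] by (auto simp: Pl_base_def)

lemma rel_plus: "w \<in> W \<Longrightarrow> Inr (wa w oneX) # w \<approx> w"
  by (rule rel_base) (auto simp: Pl_base_def)

lemma rel_t1_Inr: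
  assumes "e \<in> Xc" "set w \<subseteq> letters"
  shows "Inl t1 # Inr e # w \<approx> Inr e # w"
proof -
  have "Inl t1 # Inr e # w \<approx> Inr oneX # Inr e # w" using assms by (intro rel_t1_one) auto
  also have "\<dots> \<approx> Inr (meet oneX e) # w" using assms one_in by (intro rel_Inr_Inr) auto
  finally show ?thesis using assms by (simp add: meet_one)
qed

section \<open>Completeness: every word is related to the word of its normal form\<close>

lemma nf_word_letters: "t \<in> Tc \<Longrightarrow> nf_tail L \<Longrightarrow> set (nf_word (t, L)) \<subseteq> letters"
  by (induction "(t, L)" arbitrary: t L rule: nf_word.induct) auto

lemma nf_word_ne: "nf_word n \<noteq> []"
  by (cases n rule: nf_word.cases) auto

lemma nf_word_Words: "is_nf n \<Longrightarrow> nf_word n \<in> W"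
  using nf_word_letters[of "fst n" "snd n"] nf_word_ne[of n] by (simp add: Words_def is_nf_def)

text \<open>Each \<open>e\<close> in a normal form lies below the value of what follows it, so the
  meet with that value is \<open>e\<close> itself.\<close>

lemma nf_val_eq_wact: "t \<in> Tc \<Longrightarrow> nf_tail L \<Longrightarrow> wa (nf_word (t, L)) oneX = nf_val (t, L)"
  by (induction "(t, L)" arbitrary: t L rule: nf_word.induct) (auto simp: ltX_def leX_def)

text \<open>Every rewriting performed by \<open>lact\<close> is derivable from the defining
  relations.\<close>

lemma rel_lact:
  assumes "is_nf n" "l \<in> letters"
  shows "l # nf_word n \<approx> nf_word (lact l n)"
proof -
  obtain t L where n: "n = (t, L)" by fastforce
  have t: "t \<in> Tc" and v: "nf_val (t, L) \<in> Xc" and L: "nf_tail L"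
    using assms n nf_val_closed by (auto simp: is_nf_def)
  let ?a = "nf_word (t, L)"
  have a: "?a \<in> W" "set ?a \<subseteq> letters" using assms n nf_word_Words by (auto simp: Words_def)
  show ?thesis
  proof (cases l)
    case (Inl s)
    then have s: "s \<in> Tc" using assms by auto
    show ?thesis
    proof (cases L)
      case Nil
      then show ?thesis using n Inl rel_Inl_Inl[OF s t, of "[]"] by simp
    next
      case (Cons p L')
      then obtain e r where p: "L = (e, r) # L'" by (cases p) auto
      then have "set (Inr e # nf_word (r, L')) \<subseteq> letters" using a by auto
      then show ?thesis using n Inl rel_Inl_Inl[OF s t] p by simp
    qed
  next
    case (Inr e)
    then have e: "e \<in> Xc" using assms by auto
    let ?v = "nf_val (t, L)"
    \<comment> \<open>The word is first prefixed with its own projection, which then merges with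
      \<open>e\<close>.\<close>
    have "Inr e # ?a \<approx> Inr e # Inr ?v # ?a"
      using rel_plus[OF a(1)] nf_val_eq_wact[OF t L] e by (metis rel_sym rel_Cons UnI2 image_eqI)
    also have "\<dots> \<approx> Inr (meet e ?v) # ?a" using rel_Inr_Inr[OF e v a(2)] .
    finally have 1: "Inr e # ?a \<approx> Inr (meet e ?v) # ?a" .
    show ?thesis
    proof (cases "meet e ?v = ?v")
      case True
      then have "Inr e # ?a \<approx> ?a"
        using 1 rel_plus[OF a(1)] nf_val_eq_wact[OF t L] by (metis rel_trans)
      then show ?thesis using Inr n True by simp
    next
      case ne: False
      show ?thesis
      proof (cases "t = t1 \<and> L \<noteq> []")
        case True
        then obtain e1 s L' where L': "L = (e1, s) # L'" by (metis list.exhaust surj_pair)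
        then have e1: "e1 \<in> Xc" "s \<in> Tc" "nf_tail L'" using L by auto
        have ve: "?v = e1" using True L' e1 by (simp add: act_one)
        let ?b = "nf_word (s, L')"
        have b: "set ?b \<subseteq> letters" using e1 by (intro nf_word_letters)
        have "Inr e # ?a \<approx> Inr e # Inr e1 # ?b"
          using True L' e e1 b by (auto intro!: rel_Cons rel_t1_Inr)
        also have "\<dots> \<approx> Inr (meet e e1) # ?b" using rel_Inr_Inr[OF e e1(1) b] .
        also have "\<dots> \<approx> Inl t1 # Inr (meet e e1) # ?b"
          using e e1 b by (intro rel_sym[OF rel_t1_Inr] meet_closed)
        finally show ?thesis using Inr n ne True L' ve by simp
      next
        case False
        have "Inr (meet e ?v) # ?a \<approx> Inl t1 # Inr (meet e ?v) # ?a"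
          using e v a by (intro rel_sym[OF rel_t1_Inr] meet_closed)
        with 1 have "Inr e # ?a \<approx> Inl t1 # Inr (meet e ?v) # ?a" by (rule rel_trans)
        moreover have "lact l n = (t1, (meet e ?v, t) # L)"
          unfolding Inr n lact.simps if_not_P[OF ne] if_not_P[OF False] ..
        ultimately show ?thesis using Inr n by simp
      qed
    qed
  qed
qed

text \<open>The appended \<open>t1\<close> is the word of the empty normal form; it lets the
  induction start at \<open>w = []\<close>, which is not itself an element of
  \<open>W\<close>.\<close>

lemma rel_nf_word_nf_append: "set w \<subseteq> letters \<Longrightarrow> w @ [Inl t1] \<approx> nf_word (nf w)"
proof (induction w)
  case Nil
  show ?case by (simp add: nf_def rel_refl Words_def t1_in)
next
  case (Cons l w)
  have "l # (w @ [Inl t1]) \<approx> l # nf_word (nf w)" using Cons by (intro rel_Cons) auto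
  also have "\<dots> \<approx> nf_word (lact l (nf w))"
    using Cons.prems by (intro rel_lact) (auto simp: nf_def intro: is_nf_foldr_lact is_nf_t1)
  finally show ?case by (simp add: nf_def)
qed

lemma rel_append_t1:
  assumes "w \<in> W"
  shows "w @ [Inl t1] \<approx> w"
proof -
  obtain u l where w: "w = u @ [l]" using assms by (cases w rule: rev_cases) (auto simp: Words_def)
  have u: "set u \<subseteq> letters" and l: "l \<in> letters" using assms w by (auto simp: Words_def)
  have "[l, Inl t1] \<approx> [l]"
  proof (cases l)
    case (Inl t)
    then show ?thesis using l t1_in rel_Inl_Inl[of t t1 "[]"] by (auto simp: t1_right)
  next
    case (Inr e)
    then have e: "e \<in> Xc" using l by auto
    have "[Inr e, Inl t1] \<approx> [Inr e, Inr oneX]" using e rel_t1_one[of "[]"] by (intro rel_Cons) auto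
    also have "\<dots> \<approx> [Inr (meet e oneX)]" using e one_in by (intro rel_Inr_Inr) auto
    finally show ?thesis using Inr e by (simp add: meet_one_right)
  qed
  then show ?thesis using u w rel_append_left[of "[l, Inl t1]" "[l]" u]
    by (cases "u = []") (auto simp: Words_def)
qed

lemma rel_iff_nf:
  assumes "u \<in> W" "v \<in> W"
  shows "u \<approx> v \<longleftrightarrow> nf u = nf v"
proof
  assume eq: "nf u = nf v"
  have *: "w \<approx> nf_word (nf w)" if "w \<in> W" for w
    using rel_trans[OF rel_sym[OF rel_append_t1] rel_nf_word_nf_append] that by (simp add: Words_def)
  show "u \<approx> v" using *[OF assms(1)] rel_sym[OF *[OF assms(2)]] eq by (metis rel_trans)
qed (rule rel_nf)

lemma is_nf_nf: "set w \<subseteq> letters \<Longrightarrow> is_nf (nf w)"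
  unfolding nf_def by (intro is_nf_foldr_lact is_nf_t1)

lemma nf_val_nf: "set w \<subseteq> letters \<Longrightarrow> nf_val (nf w) = wa w oneX"
  unfolding nf_def by (simp add: nf_val_foldr_lact is_nf_t1 act_one one_in)

lemma nf_append: "nf (u @ v) = foldr lact u (nf v)"
  by (simp add: nf_def)

text \<open>Read from the right, each letter of a normal form only extends what is already built:
  the strict inequalities and the inner letters different from \<open>t1\<close> exclude the other
  cases of \<open>lact\<close>.\<close>

lemma nf_nf_word: "t \<in> Tc \<Longrightarrow> nf_tail L \<Longrightarrow> nf (nf_word (t, L)) = (t, L)"
proof (induction "(t, L)" arbitrary: t L rule: nf_word.induct)
  case (1 t)
  then show ?case by (simp add: nf_def t1_right)
next
  case (2 t e s L)
  then have IH: "foldr lact (nf_word (s, L)) (t1, []) = (s, L)" by (simp add: nf_def)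
  have lt: "meet e (nf_val (s, L)) = e" "e \<noteq> nf_val (s, L)" "L \<noteq> [] \<longrightarrow> s \<noteq> t1"
    using 2 by (auto simp: ltX_def leX_def)
  have "lact (Inr e) (s, L) = (t1, (e, s) # L)" using lt by auto
  then show ?case using 2 by (simp add: nf_def IH t1_right)
qed

section \<open>Words in \<open>T\<close>-normal form and their uniqueness in a class\<close>

abbreviation normal :: "('t + 'x) list \<Rightarrow> bool" where
  "normal \<equiv> T_normal_form Tc t1 Xc meet oneX act"

lemma all_less_Suc_Suc: "(\<forall>j<Suc (Suc n). P j) \<longleftrightarrow> P 0 \<and> P (Suc 0) \<and> (\<forall>j<n. P (Suc (Suc j)))"
  by (auto simp: less_Suc_eq_0_disj)

text \<open>Turns the conditions on positions into a recursion matching \<open>nf_word\<close>. The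
  bound on \<open>length w\<close> says that the leading letter of \<open>w\<close> is an inner
  letter of the whole word, not the final \<open>t\<^sub>n\<close>.\<close>

lemma normal_Cons_Cons:
  "normal (a # b # w) \<longleftrightarrow> (\<exists>t\<in>Tc. a = Inl t) \<and>
     (\<exists>e\<in>Xc. b = Inr e \<and> e \<noteq> oneX \<and> ltX meet e (wa w oneX)) \<and>
     (1 < length w \<longrightarrow> hd w \<noteq> Inl t1) \<and> normal w"
proof -
  have *: "(\<forall>j. 0 < j \<and> Suc j < length (a # b # w) \<and> even j \<longrightarrow> (a # b # w) ! j \<noteq> Inl t1) \<longleftrightarrow>
    (1 < length w \<longrightarrow> hd w \<noteq> Inl t1) \<and> (\<forall>j. 0 < j \<and> Suc j < length w \<and> even j \<longrightarrow> w ! j \<noteq> Inl t1)"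
    (is "?l \<longleftrightarrow> ?r")
  proof
    assume l: ?l
    have "hd w \<noteq> Inl t1" if "1 < length w"
      using l[rule_format, of 2] that by (cases w) auto
    moreover have "w ! j \<noteq> Inl t1" if "0 < j \<and> Suc j < length w \<and> even j" for j
      using l[rule_format, of "Suc (Suc j)"] that by auto
    ultimately show ?r by blast
  next
    assume r: ?r
    show ?l
    proof (intro allI impI)
      fix j assume j: "0 < j \<and> Suc j < length (a # b # w) \<and> even j"
      then have "j \<noteq> Suc 0" by auto
      with j obtain i where i: "j = Suc (Suc i)" by (metis gr0_implies_Suc neq0_conv)
      then show "(a # b # w) ! j \<noteq> Inl t1"
        using r j by (cases w; cases "i = 0") auto
    qed
  qed
  show ?thesis
    unfolding T_normal_form_def * by (auto simp: all_less_Suc_Suc)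
qed

lemma normal_singleton: "normal [a] \<longleftrightarrow> (\<exists>t\<in>Tc. a = Inl t)"
  by (auto simp: T_normal_form_def)

lemma hd_nf_word: "hd (nf_word (t, L)) = Inl t"
  by (cases "(t, L)" rule: nf_word.cases) auto

lemma length_nf_word: "length (nf_word (t, L)) = Suc (2 * length L)"
  by (induction "(t, L)" arbitrary: t L rule: nf_word.induct) auto

lemma normal_nf_word: "t \<in> Tc \<Longrightarrow> nf_tail L \<Longrightarrow> normal (nf_word (t, L))"
proof (induction "(t, L)" arbitrary: t L rule: nf_word.induct)
  case (1 t)
  then show ?case by (simp add: normal_singleton)
next
  case (2 t e s L)
  have s: "s \<in> Tc" "nf_tail L" and e: "e \<in> Xc" "ltX meet e (nf_val (s, L))" using 2 by auto
  have "nf_val (s, L) \<in> Xc" using s by (intro nf_val_closed) (simp add: is_nf_def)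
  \<comment> \<open>A strict inequality below some element of \<open>Xc\<close> rules out the
    greatest element.\<close>
  then have "e \<noteq> oneX" using e(2) by (auto simp: ltX_def leX_def meet_one)
  then show ?case
    using 2 s e by (auto simp: normal_Cons_Cons nf_val_eq_wact hd_nf_word length_nf_word)
qed

lemma normal_imp_nf_word: "normal w \<Longrightarrow> \<exists>t L. t \<in> Tc \<and> nf_tail L \<and> w = nf_word (t, L)"
proof (induction w rule: induct_list012)
  case 1
  then show ?case by (simp add: T_normal_form_def)
next
  case (2 a)
  then obtain t where "t \<in> Tc" "[a] = nf_word (t, [])" by (auto simp: normal_singleton)
  then show ?case using nf_tail.simps(1) by blast
next
  case (3 a b w)
  then obtain t e where te: "t \<in> Tc" "a = Inl t" "e \<in> Xc" "b = Inr e" "ltX meet e (wa w oneX)"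
    and w: "1 < length w \<longrightarrow> hd w \<noteq> Inl t1" "normal w"
    by (auto simp: normal_Cons_Cons)
  then obtain s L where sL: "s \<in> Tc" "nf_tail L" "w = nf_word (s, L)" using 3 by blast
  then have "nf_tail ((e, s) # L)"
    using te w by (auto simp: nf_val_eq_wact hd_nf_word length_nf_word)
  moreover have "a # b # w = nf_word (t, (e, s) # L)" using te sL by simp
  ultimately show ?case using te by blast
qed

text \<open>A class contains at most one word in normal form, which determines the choice made by
  \<open>SOME\<close> in \<open>Pl_star\<close>.\<close>

lemma normal_unique:
  assumes "normal w" "w \<approx> u"
  shows "w = nf_word (nf u)"
  using normal_imp_nf_word[OF assms(1)] nf_nf_word rel_nf[OF assms(2)] by metis

section \<open>The operations computed on classes of words\<close>

abbreviation cl :: "('t + 'x) list \<Rightarrow> ('t + 'x) list set" where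
  "cl w \<equiv> Pl_rel Tc tm t1 Xc meet oneX act `` {w}"

lemma some_cl: "w \<in> W \<Longrightarrow> w \<approx> (SOME a. a \<in> cl w)"
  by (rule someI2[of _ w]) (auto simp: rel_def[symmetric] intro: rel_refl)

lemma cl_eq_iff: "u \<in> W \<Longrightarrow> v \<in> W \<Longrightarrow> cl u = cl v \<longleftrightarrow> nf u = nf v"
  using eq_equiv_class_iff[OF equiv_rel] rel_iff_nf by (simp add: rel_def)

lemma cl_in_Pl_car: "w \<in> W \<Longrightarrow> cl w \<in> Pl_car Tc tm t1 Xc meet oneX act"
  unfolding Pl_car_def by (rule quotientI)

lemma Pl_mult_cl:
  assumes "u \<in> W" "v \<in> W"
  shows "Pl_mult Tc tm t1 Xc meet oneX act (cl u) (cl v) = cl (u @ v)"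
proof -
  let ?a = "SOME a. a \<in> cl u" and ?b = "SOME b. b \<in> cl v"
  have "u @ v \<approx> ?a @ v" using some_cl[OF assms(1)] assms by (intro rel_append_right)
  also have "\<dots> \<approx> ?a @ ?b"
    using some_cl[OF assms(2)] some_cl[OF assms(1)] rel_Words by (intro rel_append_left) auto
  finally have "cl (u @ v) = cl (?a @ ?b)"
    unfolding rel_def by (rule equiv_class_eq[OF equiv_rel])
  then show ?thesis by (simp add: Pl_mult_def)
qed

lemma Pl_plus_cl:
  assumes "u \<in> W"
  shows "Pl_plus Tc tm t1 Xc meet oneX act (cl u) = cl [Inr (nf_val (nf u))]"
proof -
  let ?a = "SOME a. a \<in> cl u"
  have "u \<approx> ?a" using some_cl[OF assms] .
  then have "nf ?a = nf u" "?a \<in> W" using rel_nf rel_Words by auto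
  then show ?thesis by (simp add: Pl_plus_def nf_val_nf[symmetric] Words_def)
qed

lemma nf_word_snoc:
  "last (nf_word (t, L @ [(e, s)])) = Inl s"
  "nf_word (t, L @ [(e, s)]) ! (length (nf_word (t, L @ [(e, s)])) - 2) = Inr e"
proof -
  have "\<exists>u. nf_word (t, L @ [(e, s)]) = u @ [Inr e, Inl s]"
  proof (induction L arbitrary: t)
    case (Cons p L)
    obtain f r where p: "p = (f, r)" by fastforce
    obtain u where "nf_word (r, L @ [(e, s)]) = u @ [Inr e, Inl s]" using Cons by blast
    then have "nf_word (t, (p # L) @ [(e, s)]) = (Inl t # Inr f # u) @ [Inr e, Inl s]"
      using p by simp
    then show ?case by blast
  qed simp
  then obtain u where "nf_word (t, L @ [(e, s)]) = u @ [Inr e, Inl s]" ..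
  then show "last (nf_word (t, L @ [(e, s)])) = Inl s"
    "nf_word (t, L @ [(e, s)]) ! (length (nf_word (t, L @ [(e, s)])) - 2) = Inr e"
    by (auto simp: nth_append)
qed

text \<open>The word chosen by \<open>SOME\<close> is \<open>nf_word (nf u)\<close>. Its last pair
  \<open>(e, t1)\<close> selects the first branch of \<open>Pl_star\<close>: the length is at least
  3 and the last letter but one is \<open>e\<close>.\<close>

lemma Pl_star_cl:
  assumes u: "u \<in> W" and nfu: "nf u = (t, L @ [(e, t1)])"
  shows "Pl_star Tc tm t1 Xc meet oneX act (cl u) = cl [Inr e]"
proof -
  let ?n = "nf_word (nf u)"
  have nf: "is_nf (nf u)" using u by (intro is_nf_nf) (simp add: Words_def)
  have tL: "t \<in> Tc" "nf_tail (L @ [(e, t1)])" using nf nfu by (auto simp: is_nf_def)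
  have "nf ?n = nf u" using nf_nf_word[OF tL] nfu by simp
  then have "u \<approx> ?n" using rel_iff_nf[OF u nf_word_Words[OF nf]] by simp
  moreover have "normal ?n" using normal_nf_word[OF tL] nfu by simp
  ultimately have "(SOME w. w \<in> cl u \<and> normal w) = ?n"
    by (intro some_equality) (auto simp: rel_def[symmetric] intro: normal_unique rel_sym)
  then show ?thesis
    using nfu nf_word_snoc[of t L e t1] by (simp add: Pl_star_def length_nf_word)
qed

end

lemma all_nat_split_first: "(\<forall>i. P i) \<longleftrightarrow> P 0 \<and> (\<forall>i. P (Suc i))" for P :: "nat \<Rightarrow> bool"
  using not0_implies_Suc by metis

section \<open>Proper bases\<close>

locale proper_basis_monoid =
  fixes mult :: "'q \<Rightarrow> 'q \<Rightarrow> 'q" (infixl "\<cdot>" 70) and one :: 'q and pl st :: "'q \<Rightarrow> 'q" and H :: "'q set"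
  assumes ehresmann: "star_left_ehresmann mult one pl st"
    and basis: "proper_basis mult one pl st H"
begin

abbreviation E :: "'q set" where
  "E \<equiv> range pl"

lemma mult_assoc: "x \<cdot> y \<cdot> z = x \<cdot> (y \<cdot> z)"
  and one_left: "one \<cdot> x = x"
  and one_right: "x \<cdot> one = x"
  and pl_absorb: "pl x \<cdot> x = x"
  and pl_pl_mult: "pl (pl x \<cdot> pl y) = pl x \<cdot> pl y"
  and pl_comm: "pl x \<cdot> pl y = pl y \<cdot> pl x"
  and pl_mult: "pl (x \<cdot> y) = pl (x \<cdot> pl y)"
  and st_absorb: "x \<cdot> st x = x"
  and st_st: "st (st x) = st x"
  and st_mult_st: "st (x \<cdot> st y) \<cdot> st y = st (x \<cdot> st y)"
  and pl_st: "pl (st x) = st x"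
  and st_pl: "st (pl x) = pl x"
  and range_st: "range st = E"
  using ehresmann unfolding star_left_ehresmann_def by auto

lemma pl_E: "e \<in> E \<Longrightarrow> pl e = e"
  using pl_st st_pl by (metis imageE)

lemma st_E: "e \<in> E \<Longrightarrow> st e = e"
  using st_pl by auto

lemma st_in_E: "st x \<in> E"
  using range_st by blast

lemma E_idem: "e \<in> E \<Longrightarrow> e \<cdot> e = e"
  using pl_absorb pl_E by metis

lemma E_comm: "e \<in> E \<Longrightarrow> f \<in> E \<Longrightarrow> e \<cdot> f = f \<cdot> e"
  using pl_comm by auto

lemma E_mult:
  assumes "e \<in> E" "f \<in> E"
  shows "e \<cdot> f \<in> E"
  using rangeI[of pl "e \<cdot> f"] pl_pl_mult[of e f] unfolding assms[THEN pl_E] by (simp only:)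

lemma one_in_E: "one \<in> E"
  using pl_absorb[of one] rangeI[of pl one] by (simp add: one_right)

text \<open>Writing \<open>x\<close> as \<open>pl x \<cdot> x\<close> exhibits
  \<open>pl (x \<cdot> y)\<close> as a multiple of \<open>pl x\<close>.\<close>

lemma pl_mult_le: "pl (x \<cdot> y) \<cdot> pl x = pl (x \<cdot> y)"
proof -
  have "pl (x \<cdot> y) = pl (pl x \<cdot> (x \<cdot> y))" by (simp add: mult_assoc[symmetric] pl_absorb)
  also have "\<dots> = pl x \<cdot> pl (x \<cdot> y)" by (subst pl_mult) (rule pl_pl_mult)
  finally show ?thesis by (simp add: pl_comm)
qed

lemma E_le_trans: "e \<cdot> f = e \<Longrightarrow> f \<cdot> g = f \<Longrightarrow> e \<cdot> g = e"
  by (metis mult_assoc)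

section \<open>The congruence \<sigma> and the quotient monoid \<open>T\<close>\<close>

abbreviation \<sigma> :: "('q \<times> 'q) set" where
  "\<sigma> \<equiv> sigmaQ mult pl"

abbreviation cls :: "'q \<Rightarrow> 'q set" where
  "cls q \<equiv> \<sigma> `` {q}"

abbreviation T :: "'q set set" where
  "T \<equiv> Tcar mult pl"

lemma sigma_mult: "(a, b) \<in> \<sigma> \<Longrightarrow> (c \<cdot> a, c \<cdot> b) \<in> \<sigma>" "(a, b) \<in> \<sigma> \<Longrightarrow> (a \<cdot> c, b \<cdot> c) \<in> \<sigma>"
  unfolding sigmaQ_def monoid_cong_def by blast+

lemma sigma_E: "e \<in> E \<Longrightarrow> f \<in> E \<Longrightarrow> (e, f) \<in> \<sigma>"
  unfolding sigmaQ_def by blast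

lemma equiv_sigma: "equiv UNIV \<sigma>"
proof (rule equivI)
  show "refl \<sigma>" unfolding sigmaQ_def monoid_cong_def equiv_def refl_on_def by blast
  show "sym \<sigma>" unfolding sigmaQ_def monoid_cong_def equiv_def sym_def by blast
  show "trans \<sigma>"
  proof (rule transI, unfold sigmaQ_def, rule InterI)
    fix a b c C
    assume C: "C \<in> {R. monoid_cong mult R \<and> E \<times> E \<subseteq> R}"
      and "(a, b) \<in> \<Inter> {R. monoid_cong mult R \<and> E \<times> E \<subseteq> R}"
        "(b, c) \<in> \<Inter> {R. monoid_cong mult R \<and> E \<times> E \<subseteq> R}"
    then have "(a, b) \<in> C" "(b, c) \<in> C" by blast+
    moreover have "trans C" using C by (simp add: monoid_cong_def equiv_def)
    ultimately show "(a, c) \<in> C" by (rule transD[rotated])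
  qed
qed simp

lemma cls_eq_iff: "cls a = cls b \<longleftrightarrow> (a, b) \<in> \<sigma>"
  using eq_equiv_class_iff[OF equiv_sigma] by simp

lemma cls_self: "q \<in> cls q"
  using equiv_class_self[OF equiv_sigma] by simp

lemma cls_mult_cong: "cls a = cls b \<Longrightarrow> cls c = cls d \<Longrightarrow> cls (a \<cdot> c) = cls (b \<cdot> d)"
  using sigma_mult unfolding cls_eq_iff[symmetric] by metis

lemma Tmult_cls: "Tmult mult pl (cls a) (cls b) = cls (a \<cdot> b)"
proof -
  have "cls (SOME x. x \<in> cls c) = cls c" for c
    using cls_self[of c] by (rule someI2) (auto simp: cls_eq_iff intro: equiv_sigma[THEN equivE, THEN symD])
  then show ?thesis unfolding Tmult_def by (intro cls_mult_cong)
qed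

lemma Tone_cls: "Tone mult one pl = cls one"
  by (simp add: Tone_def)

lemma Tcar_cls: "T = range cls"
  by (auto simp: Tcar_def quotient_def)

lemma cls_E: "e \<in> E \<Longrightarrow> cls e = cls one"
  by (simp add: cls_eq_iff sigma_E one_in_E)

lemma cls_mult_E: "e \<in> E \<Longrightarrow> cls (q \<cdot> e) = cls q"
  using cls_mult_cong[OF refl cls_E, of e q] by (simp add: one_right)

section \<open>Consequences of atomicity and properness\<close>

lemma atomic: "atomic mult pl st H" and proper: "proper_set mult pl st H"
  and canonical: "has_canonical_forms mult one pl st H"
  using basis by (auto simp: proper_basis_def)

lemma E_H: "e \<in> E \<Longrightarrow> e \<in> H"
  and H_mult_E: "h \<in> H \<Longrightarrow> e \<in> E \<Longrightarrow> h \<cdot> e \<in> H \<and> st (h \<cdot> e) = st h \<cdot> e"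
  and H_mult_not_E: "h \<in> H \<Longrightarrow> k \<in> H \<Longrightarrow> k \<notin> E \<Longrightarrow> pl k \<cdot> st h = pl k \<Longrightarrow> h \<cdot> k \<in> H \<and> st (h \<cdot> k) = st k"
  and H_dense: "\<exists>h\<in>H. cls h = cls m"
  using atomic unfolding atomic_def leE_def cls_eq_iff[symmetric] by (blast, blast, blast, metis)

lemma H_extend:
  "h \<in> H \<Longrightarrow> k \<in> H \<Longrightarrow> w \<in> H \<Longrightarrow> cls (h \<cdot> k) = cls w \<Longrightarrow> st k = st w \<Longrightarrow>
   \<exists>u\<in>H. cls u = cls h \<and> pl k \<cdot> st u = pl k"
  using atomic unfolding atomic_def leE_def cls_eq_iff[symmetric] by blast

text \<open>Combines (H3) with (H2), the latter covering the case that \<open>k\<close> is a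
  projection.\<close>

lemma H_mult:
  assumes "h \<in> H" "k \<in> H" "pl k \<cdot> st h = pl k"
  shows "h \<cdot> k \<in> H \<and> st (h \<cdot> k) = st k"
proof (cases "k \<in> E")
  case True
  then show ?thesis
    using H_mult_E[OF assms(1) True] assms(3) E_comm[OF True st_in_E]
    unfolding pl_E[OF True] st_E[OF True] by simp
qed (use assms H_mult_not_E in blast)

lemma H_proper: "h \<in> H \<Longrightarrow> k \<in> H \<Longrightarrow> st h = st k \<Longrightarrow> cls h = cls k \<Longrightarrow> h = k"
  using proper unfolding proper_set_def cls_eq_iff by blast

text \<open>If \<open>h\<close> has the class of \<open>one\<close>, then \<open>h\<close> and the
  projection \<open>st h\<close> agree in class and star, so properness makes them equal.\<close>

lemma H_cls_one_iff: "h \<in> H \<Longrightarrow> cls h = cls one \<longleftrightarrow> h \<in> E"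
  using H_proper[of h "st h"] cls_E[OF st_in_E, of h] cls_E[of h] st_in_E[of h] E_H[OF st_in_E, of h]
  by (auto simp: st_st)

section \<open>The semilattice\<close>

text \<open>A pair \<open>(t, e)\<close> with \<open>t \<in> T\<close> and \<open>e \<in> E\<close> is encoded as \<open>t \<times> {e}\<close>. The additional point
  \<open>{}\<close> keeps the identity of the semilattice outside the image of \<open>E\<close>, so that every
  normal form met below ends in \<open>e\<^sub>n 1\<close>.\<close>

abbreviation pt :: "'q \<Rightarrow> 'q \<Rightarrow> ('q \<times> 'q) set" where
  "pt q e \<equiv> cls q \<times> {e}"

definition points :: "('q \<times> 'q) set set" where
  "points = {pt q e | q e. e \<in> E} \<union> {{}}"

text \<open>The partial action \<open>[k] \<cdot> k\<^sup>* = k\<^sup>+\<close> (\<open>k \<in> H\<close>) of \<open>T\<close> on \<open>E\<close> is made total by identifying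
  \<open>(t[k], k\<^sup>*)\<close> with \<open>(t, k\<^sup>+)\<close> and passing to down-closed sets.\<close>

definition X :: "('q \<times> 'q) set set set" where
  "X = {A. A \<subseteq> points \<and>
     (\<forall>q. \<forall>e\<in>E. \<forall>f\<in>E. e \<cdot> f = e \<and> pt q f \<in> A \<longrightarrow> pt q e \<in> A) \<and>
     (\<forall>q. \<forall>k\<in>H. pt (q \<cdot> k) (st k) \<in> A \<longleftrightarrow> pt q (pl k) \<in> A)}"

text \<open>Left translation of the first coordinate; \<open>fst\<close> and \<open>snd\<close>
  decode \<open>t \<times> {e}\<close>, and the point \<open>{}\<close> stays fixed.\<close>

definition shift :: "'q set \<Rightarrow> ('q \<times> 'q) set \<Rightarrow> ('q \<times> 'q) set" where
  "shift t p = Tmult mult pl t (fst ` p) \<times> snd ` p"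

text \<open>The translate of \<open>A\<close> is closed off to the least member of \<open>X\<close>
  containing it, so \<open>acts t\<close> is left adjoint to taking preimages under
  \<open>shift t\<close>.\<close>

definition acts :: "'q set \<Rightarrow> ('q \<times> 'q) set set \<Rightarrow> ('q \<times> 'q) set set" where
  "acts t A = \<Inter> {B \<in> X. shift t ` A \<subseteq> B}"

text \<open>The pairs \<open>(t, g)\<close> for which \<open>t \<cdot> g\<close> is defined in
  \<open>E\<close> and lies below \<open>e\<close>.\<close>

definition \<psi> :: "'q \<Rightarrow> ('q \<times> 'q) set set" where
  "\<psi> e = {pt h (st h) | h. h \<in> H \<and> pl h \<cdot> e = pl h}"

lemma pt_eq_iff: "pt q e = pt r f \<longleftrightarrow> cls q = cls r \<and> e = f"
  using cls_self by (auto simp: times_eq_iff)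

lemma pt_ne: "pt q e \<noteq> {}"
  using cls_self by auto

lemma shift_pt: "shift (cls a) (pt q e) = pt (a \<cdot> q) e"
proof -
  have "fst ` pt q e = cls q" "snd ` pt q e = {e}" using cls_self[of q] by force+
  then show ?thesis unfolding shift_def by (simp add: Tmult_cls)
qed

lemma shift_empty: "shift t {} = {}"
  by (simp add: shift_def)

lemma points_cases:
  assumes "p \<in> points"
  obtains q e where "e \<in> E" "p = pt q e" | "p = {}"
  using assms unfolding points_def by blast

lemma pt_in_points_iff: "pt q e \<in> points \<longleftrightarrow> e \<in> E"
  using pt_ne by (auto simp: points_def pt_eq_iff)

lemma shift_points: "p \<in> points \<Longrightarrow> shift (cls a) p \<in> points"
  by (erule points_cases) (auto simp: shift_pt shift_empty pt_in_points_iff, auto simp: points_def)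

lemma shift_one: "p \<in> points \<Longrightarrow> shift (cls one) p = p"
  by (erule points_cases) (auto simp only: shift_pt shift_empty one_left)

lemma shift_shift: "p \<in> points \<Longrightarrow> shift (cls a) (shift (cls b) p) = shift (cls (a \<cdot> b)) p"
  by (erule points_cases) (auto simp only: shift_pt shift_empty mult_assoc)

lemma points_in_X: "points \<in> X"
  by (auto simp only: X_def mem_Collect_eq pt_in_points_iff st_in_E)

lemma X_subset: "A \<in> X \<Longrightarrow> A \<subseteq> points"
  by (simp add: X_def)

lemma X_Inter: "F \<subseteq> X \<Longrightarrow> F \<noteq> {} \<Longrightarrow> \<Inter> F \<in> X"
proof -
  assume F: "F \<subseteq> X" "F \<noteq> {}"
  have "\<Inter> F \<subseteq> points" using F X_subset by fastforce
  moreover have "pt q e \<in> \<Inter> F" if "e \<in> E" "f \<in> E" "e \<cdot> f = e" "pt q f \<in> \<Inter> F" for q e f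
    using F(1) that unfolding X_def by blast
  moreover have "pt (q \<cdot> k) (st k) \<in> A \<longleftrightarrow> pt q (pl k) \<in> A" if "k \<in> H" "A \<in> F" for q k A
    using F(1) that unfolding X_def by blast
  ultimately show ?thesis unfolding X_def by blast
qed

lemma X_Int: "A \<in> X \<Longrightarrow> B \<in> X \<Longrightarrow> A \<inter> B \<in> X"
  using X_Inter[of "{A, B}"] by simp

text \<open>The closure conditions of \<open>X\<close> hold for all \<open>q\<close>, and replacing
  \<open>q\<close> by \<open>a \<cdot> q\<close> commutes with multiplying by \<open>k\<close> on
  the right.\<close>

lemma X_preimage:
  assumes "B \<in> X"
  shows "{p \<in> points. shift (cls a) p \<in> B} \<in> X"
  using assms unfolding X_def
  by (auto simp: pt_in_points_iff shift_pt mult_assoc[symmetric] st_in_E)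

lemma acts_in_X: "A \<subseteq> points \<Longrightarrow> acts (cls a) A \<in> X"
  unfolding acts_def using points_in_X shift_points by (intro X_Inter) blast+

lemma shift_in_acts: "p \<in> A \<Longrightarrow> shift t p \<in> acts t A"
  unfolding acts_def by blast

lemma acts_least: "B \<in> X \<Longrightarrow> shift t ` A \<subseteq> B \<Longrightarrow> acts t A \<subseteq> B"
  unfolding acts_def by blast

lemma acts_one: "A \<in> X \<Longrightarrow> acts (cls one) A = A"
proof
  assume A: "A \<in> X"
  have *: "shift (cls one) p = p" if "p \<in> A" for p using shift_one X_subset[OF A] that by blast
  show "acts (cls one) A \<subseteq> A" using A * by (intro acts_least) auto
  show "A \<subseteq> acts (cls one) A" using shift_in_acts[of _ A "cls one"] * by auto
qed

lemma acts_acts: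
  assumes "A \<in> X"
  shows "acts (cls (a \<cdot> b)) A = acts (cls a) (acts (cls b) A)"
proof
  have A: "A \<subseteq> points" using assms by (rule X_subset)
  have bA: "acts (cls b) A \<in> X" using A by (rule acts_in_X)
  have sh: "shift (cls (a \<cdot> b)) p = shift (cls a) (shift (cls b) p)" if "p \<in> A" for p
    using shift_shift A that by auto
  show "acts (cls (a \<cdot> b)) A \<subseteq> acts (cls a) (acts (cls b) A)"
    using sh by (intro acts_least acts_in_X X_subset[OF bA]) (auto intro: shift_in_acts)
  let ?B = "acts (cls (a \<cdot> b)) A"
  \<comment> \<open>By adjointness the inclusion is tested on a preimage, which already contains the
    translates of \<open>A\<close> by \<open>cls b\<close>.\<close>
  have "acts (cls b) A \<subseteq> {p \<in> points. shift (cls a) p \<in> ?B}"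
    using A sh by (intro acts_least X_preimage acts_in_X) (auto simp: sh[symmetric] shift_points intro: shift_in_acts)
  then show "acts (cls a) (acts (cls b) A) \<subseteq> ?B"
    using A by (intro acts_least acts_in_X) auto
qed

lemma acts_mono: "A \<subseteq> B \<Longrightarrow> acts t A \<subseteq> acts t B"
  unfolding acts_def by (intro Inter_anti_mono) auto

section \<open>The embedding of \<open>E\<close> and the extension of the partial action\<close>

lemma pt_in_psi_iff: "pt q g \<in> \<psi> e \<longleftrightarrow> (\<exists>h\<in>H. cls h = cls q \<and> st h = g \<and> pl h \<cdot> e = pl h)"
  unfolding \<psi>_def by (auto simp only: mem_Collect_eq pt_eq_iff)

text \<open>The only members of \<open>H\<close> in the class of \<open>one\<close> are projections,
  so the witness has to be \<open>f\<close> itself.\<close>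

lemma pt_one_in_psi_iff: "f \<in> E \<Longrightarrow> pt one f \<in> \<psi> e \<longleftrightarrow> f \<cdot> e = f"
  using H_cls_one_iff E_H[of f] unfolding pt_in_psi_iff by (metis pl_E st_E)

lemma empty_notin_psi: "{} \<notin> \<psi> e"
  using pt_ne unfolding \<psi>_def by auto

text \<open>Down-closure comes from (H2). In the equivalence, extending a witness by
  \<open>k\<close> uses (H3), and removing \<open>k\<close> from it uses (H5).\<close>

lemma psi_in_X: "\<psi> e \<in> X"
  unfolding X_def
proof (intro CollectI conjI allI ballI impI)
  show "\<psi> e \<subseteq> points" unfolding \<psi>_def points_def using st_in_E by blast
next
  fix q f g assume f: "f \<in> E" and g: "g \<in> E" and "f \<cdot> g = f \<and> pt q g \<in> \<psi> e"
  then obtain h where h: "h \<in> H" "cls h = cls q" "st h = g" "pl h \<cdot> e = pl h" and fg: "f \<cdot> g = f"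
    unfolding pt_in_psi_iff by blast
  have "h \<cdot> f \<in> H" "st (h \<cdot> f) = f" using H_mult_E[OF h(1) f] h(3) fg E_comm[OF f g] by auto
  moreover have "cls (h \<cdot> f) = cls q" using h(2) cls_mult_E[OF f] by simp
  moreover have "pl (h \<cdot> f) \<cdot> e = pl (h \<cdot> f)" using pl_mult_le h(4) by (rule E_le_trans)
  ultimately show "pt q f \<in> \<psi> e" unfolding pt_in_psi_iff by blast
next
  fix q k assume k: "k \<in> H"
  show "pt (q \<cdot> k) (st k) \<in> \<psi> e \<longleftrightarrow> pt q (pl k) \<in> \<psi> e"
  proof
    assume "pt (q \<cdot> k) (st k) \<in> \<psi> e"
    then obtain w where w: "w \<in> H" "cls w = cls (q \<cdot> k)" "st w = st k" "pl w \<cdot> e = pl w"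
      unfolding pt_in_psi_iff by blast
    obtain h where h: "h \<in> H" "cls h = cls q" using H_dense by blast
    have "cls (h \<cdot> k) = cls w" using cls_mult_cong[OF h(2) refl] w(2) by simp
    \<comment> \<open>(H5) supplies a member of the class of \<open>q\<close> whose star is large
      enough to be multiplied by \<open>k\<close> inside \<open>H\<close>; properness then
      identifies \<open>u \<cdot> k\<close> with \<open>w\<close>.\<close>
    then obtain u where u: "u \<in> H" "cls u = cls h" "pl k \<cdot> st u = pl k"
      using H_extend[OF h(1) k w(1)] w(3) by auto
    have "u \<cdot> k \<in> H" "st (u \<cdot> k) = st k" using H_mult[OF u(1) k u(3)] by auto
    moreover have "cls (u \<cdot> k) = cls w" using cls_mult_cong[OF u(2) refl] \<open>cls (h \<cdot> k) = cls w\<close> by simp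
    ultimately have uk: "u \<cdot> k = w" using H_proper w by simp
    \<comment> \<open>Cutting \<open>u\<close> down to star \<open>pl k\<close> gives the witness;
      its projection is that of \<open>u \<cdot> k = w\<close>.\<close>
    have "u \<cdot> pl k \<in> H" "st (u \<cdot> pl k) = pl k"
      using H_mult_E[OF u(1), of "pl k"] u(3) E_comm[OF st_in_E, of "pl k" u] by auto
    moreover have "cls (u \<cdot> pl k) = cls q" using cls_mult_E[of "pl k" u] u(2) h(2) by simp
    moreover have "pl (u \<cdot> pl k) \<cdot> e = pl (u \<cdot> pl k)" using w(4) uk pl_mult[of u k] by simp
    ultimately show "pt q (pl k) \<in> \<psi> e" unfolding pt_in_psi_iff by blast
  next
    assume "pt q (pl k) \<in> \<psi> e"
    then obtain u where u: "u \<in> H" "cls u = cls q" "st u = pl k" "pl u \<cdot> e = pl u"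
      unfolding pt_in_psi_iff by blast
    have "u \<cdot> k \<in> H" "st (u \<cdot> k) = st k" using H_mult[OF u(1) k] u(3) by (auto simp: E_idem)
    moreover have "cls (u \<cdot> k) = cls (q \<cdot> k)" using cls_mult_cong[OF u(2) refl] .
    moreover have "pl (u \<cdot> k) \<cdot> e = pl (u \<cdot> k)" using pl_mult_le u(4) by (rule E_le_trans)
    ultimately show "pt (q \<cdot> k) (st k) \<in> \<psi> e" unfolding pt_in_psi_iff by blast
  qed
qed

text \<open>The point \<open>pt one e\<close> of \<open>\<psi> e\<close> detects the order.\<close>

lemma psi_le_iff:
  assumes "e \<in> E"
  shows "\<psi> e \<subseteq> \<psi> f \<longleftrightarrow> e \<cdot> f = e"
proof
  assume "\<psi> e \<subseteq> \<psi> f"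
  moreover have "pt one e \<in> \<psi> e" using assms by (simp add: pt_one_in_psi_iff E_idem)
  ultimately show "e \<cdot> f = e" using pt_one_in_psi_iff assms by blast
next
  assume "e \<cdot> f = e"
  then show "\<psi> e \<subseteq> \<psi> f" unfolding \<psi>_def using E_le_trans by blast
qed

lemma psi_inj: "e \<in> E \<Longrightarrow> f \<in> E \<Longrightarrow> \<psi> e = \<psi> f \<Longrightarrow> e = f"
  using psi_le_iff[of e f] psi_le_iff[of f e] E_comm by force

lemma psi_mult:
  assumes "e \<in> E" "f \<in> E"
  shows "\<psi> (e \<cdot> f) = \<psi> e \<inter> \<psi> f"
proof
  have "e \<cdot> f \<cdot> e = e \<cdot> f" "e \<cdot> f \<cdot> f = e \<cdot> f"
    using assms by (metis E_comm E_idem mult_assoc)+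
  then show "\<psi> (e \<cdot> f) \<subseteq> \<psi> e \<inter> \<psi> f" using psi_le_iff E_mult assms by simp
  show "\<psi> e \<inter> \<psi> f \<subseteq> \<psi> (e \<cdot> f)"
  proof
    fix p assume p: "p \<in> \<psi> e \<inter> \<psi> f"
    then obtain h where h: "h \<in> H" "p = pt h (st h)" "pl h \<cdot> e = pl h" unfolding \<psi>_def by blast
    \<comment> \<open>The witness for \<open>p \<in> \<psi> f\<close> has the class and star of
      \<open>h\<close>, so properness makes it \<open>h\<close>.\<close>
    then have "pl h \<cdot> f = pl h" using p pt_in_psi_iff[of h "st h" f] H_proper by auto
    then have "pl h \<cdot> (e \<cdot> f) = pl h" using h(3) by (simp add: mult_assoc[symmetric])
    then show "p \<in> \<psi> (e \<cdot> f)" unfolding \<psi>_def using h by blast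
  qed
qed

text \<open>The action on \<open>X\<close> extends the partial action on \<open>E\<close>.
  Translates of points of \<open>\<psi> (st h)\<close> stay in \<open>\<psi> (pl h)\<close> because
  the products \<open>h \<cdot> k\<close> remain in \<open>H\<close>; the closure conditions of
  \<open>X\<close> give the other inclusion.\<close>

lemma acts_psi:
  assumes h: "h \<in> H"
  shows "acts (cls h) (\<psi> (st h)) = \<psi> (pl h)"
proof
  show "acts (cls h) (\<psi> (st h)) \<subseteq> \<psi> (pl h)"
  proof (rule acts_least[OF psi_in_X], clarify)
    fix p assume "p \<in> \<psi> (st h)"
    then obtain k where k: "k \<in> H" "p = pt k (st k)" "pl k \<cdot> st h = pl k" unfolding \<psi>_def by blast
    then have "h \<cdot> k \<in> H" "st (h \<cdot> k) = st k" using H_mult[OF h] by auto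
    then show "shift (cls h) p \<in> \<psi> (pl h)"
      unfolding k(2) shift_pt pt_in_psi_iff using pl_mult_le by blast
  qed
  show "\<psi> (pl h) \<subseteq> acts (cls h) (\<psi> (st h))"
  proof
    let ?B = "acts (cls h) (\<psi> (st h))"
    have B: "?B \<in> X" using X_subset[OF psi_in_X] by (rule acts_in_X)
    fix p assume "p \<in> \<psi> (pl h)"
    then obtain k where k: "k \<in> H" "p = pt k (st k)" "pl k \<cdot> pl h = pl k" unfolding \<psi>_def by blast
    \<comment> \<open>The chain runs from \<open>(h, st h)\<close> to \<open>(one, pl h)\<close> by
      removing \<open>h\<close>, down to \<open>(one, pl k)\<close>, and back up to
      \<open>(k, st k)\<close> by attaching \<open>k\<close>.\<close>
    have "pt one (st h) \<in> \<psi> (st h)" by (simp only: pt_one_in_psi_iff st_in_E E_idem)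
    then have "shift (cls h) (pt one (st h)) \<in> ?B" by (rule shift_in_acts)
    then have "pt (one \<cdot> h) (st h) \<in> ?B" by (simp only: shift_pt one_left one_right)
    then have "pt one (pl h) \<in> ?B" using B h unfolding X_def by blast
    then have "pt one (pl k) \<in> ?B" using B k(3) unfolding X_def by blast
    then have "pt (one \<cdot> k) (st k) \<in> ?B" using B k(1) unfolding X_def by blast
    then show "p \<in> ?B" by (simp only: k(2) one_left)
  qed
qed

text \<open>Conversely, the image of \<open>E\<close> is reached only where the partial action is
  defined, since the translate of \<open>pt one e\<close> must lie in \<open>\<psi> f\<close>. Hence
  the generators of \<open>QY\<close> come from \<open>H\<close>.\<close>

lemma acts_psi_imp_H:
  assumes "e \<in> E" "acts (cls q) (\<psi> e) = \<psi> f"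
  shows "\<exists>h\<in>H. cls h = cls q \<and> st h = e"
proof -
  have "pt one e \<in> \<psi> e" using assms(1) by (simp add: pt_one_in_psi_iff E_idem)
  then have "shift (cls q) (pt one e) \<in> \<psi> f" using assms(2) shift_in_acts by blast
  then have "pt q e \<in> \<psi> f" by (simp only: shift_pt one_right)
  then show ?thesis unfolding pt_in_psi_iff by blast
qed

lemma X_semilattice: "semilattice_with_identity X (\<inter>) points"
  unfolding semilattice_with_identity_def using points_in_X X_Int X_subset by auto

lemma acts_action: "order_preserving_left_action T (Tmult mult pl) (cls one) X (\<inter>) acts"
  unfolding order_preserving_left_action_def Tcar_cls leX_def
  using acts_in_X[OF X_subset] acts_one acts_acts acts_mono
  by (simp add: Tmult_cls inf.absorb_iff1[symmetric])

sublocale P: monoid_acting_on_semilattice T "Tmult mult pl" "cls one" X "(\<inter>)" points acts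
  using X_semilattice acts_action
  by unfold_locales (auto simp: Tcar_cls Tmult_cls mult_assoc one_left one_right)

section \<open>Canonical forms and normal forms\<close>

abbreviation canonical_list :: "'q list \<Rightarrow> bool" where
  "canonical_list \<equiv> canonical_form mult pl st H"

abbreviation lp :: "'q list \<Rightarrow> 'q" where
  "lp \<equiv> lprod mult one"

lemma canonical_Nil: "\<not> canonical_list []"
  by (simp add: canonical_form_def)

lemma canonical_single: "canonical_list [h] \<longleftrightarrow> h \<in> H"
  by (auto simp: canonical_form_def)

lemma canonical_Cons_Cons:
  "canonical_list (h # k # ks) \<longleftrightarrow>
     h \<in> H \<and> st h \<cdot> pl k = st h \<and> st h \<noteq> pl k \<and> k \<notin> E \<and> canonical_list (k # ks)"
proof -
  have 1: "(\<forall>i. Suc i < length (h # k # ks) \<longrightarrow> ltE mult (st ((h # k # ks) ! i)) (pl ((h # k # ks) ! Suc i)))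
    \<longleftrightarrow> ltE mult (st h) (pl k) \<and>
      (\<forall>i. Suc i < length (k # ks) \<longrightarrow> ltE mult (st ((k # ks) ! i)) (pl ((k # ks) ! Suc i)))"
    by (subst all_nat_split_first) simp
  have 2: "(\<forall>i. 0 < i \<and> i < length (h # k # ks) \<longrightarrow> (h # k # ks) ! i \<notin> E)
    \<longleftrightarrow> k \<notin> E \<and> (\<forall>i. 0 < i \<and> i < length (k # ks) \<longrightarrow> (k # ks) ! i \<notin> E)"
    by (subst all_nat_split_first, simp, subst all_nat_split_first)
      (auto simp: gr0_conv_Suc)
  show ?thesis unfolding canonical_form_def 1 2 by (auto simp: ltE_def leE_def)
qed

text \<open>Each pair joins the star of one factor to the class of the next, so \<open>h\<close> is
  the factor whose class has already been written; the last pair carries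
  \<open>t\<^sub>n = 1\<close>.\<close>

fun nf_steps :: "'q \<Rightarrow> 'q list \<Rightarrow> (('q \<times> 'q) set set \<times> 'q set) list" where
  "nf_steps h [] = [(\<psi> (st h), cls one)]"
| "nf_steps h (k # ks) = (\<psi> (st h), cls k) # nf_steps k ks"

text \<open>The canonical form \<open>h\<^sub>1 \<dots> h\<^sub>n\<close> becomes the normal form \<open>[h\<^sub>1] \<psi>(h\<^sub>1\<^sup>*) \<dots> [h\<^sub>n] \<psi>(h\<^sub>n\<^sup>*) 1\<close>.\<close>

definition cnf :: "'q list \<Rightarrow> 'q set \<times> (('q \<times> 'q) set set \<times> 'q set) list" where
  "cnf hs = (cls (hd hs), nf_steps (hd hs) (tl hs))"

definition word :: "'q list \<Rightarrow> ('q set + ('q \<times> 'q) set set) list" where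
  "word hs = concat (map (\<lambda>h. [Inl (cls h), Inr (\<psi> (st h))]) hs)"

lemma word_simps: "word [] = []" "word (h # hs) = Inl (cls h) # Inr (\<psi> (st h)) # word hs"
  by (simp_all add: word_def)

lemma word_append: "word (hs @ ks) = word hs @ word ks"
  by (simp add: word_def)

lemma word_letters: "set (word hs) \<subseteq> P.letters"
  by (induction hs) (auto simp: word_simps Tcar_cls psi_in_X)

lemma word_Words: "hs \<noteq> [] \<Longrightarrow> word hs \<in> P.W"
  using word_letters[of hs] by (cases hs) (auto simp: Words_def word_simps)

lemma nf_steps_ne: "nf_steps h hs \<noteq> []"
  by (cases hs) auto

lemma nf_val_cnf: "k \<in> H \<Longrightarrow> P.nf_val (cnf (k # ks)) = \<psi> (pl k)"
  by (cases ks) (auto simp: cnf_def acts_psi)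

text \<open>The extra point \<open>{}\<close> separates them, so no letter from
  \<open>\<psi>\<close> is the identity of \<open>X\<close>.\<close>

lemma psi_ne_points: "\<psi> e \<noteq> points"
  using empty_notin_psi by (auto simp: points_def)

lemma nf_word_single: "h \<in> H \<Longrightarrow> P.nf (word [h]) = cnf [h]"
proof -
  have "acts (cls one) points = points" using points_in_X by (rule acts_one)
  moreover have "\<psi> (st h) \<inter> points = \<psi> (st h)" using X_subset[OF psi_in_X] by blast
  ultimately show ?thesis
    using psi_ne_points[of "st h"]
    by (simp add: P.nf_def word_simps cnf_def Tmult_cls one_right)
qed

lemma lact_psi:
  assumes "k \<in> H"
  shows "P.lact (Inr (\<psi> e)) (cnf (k # ks)) =
    (if \<psi> e \<inter> \<psi> (pl k) = \<psi> (pl k) then cnf (k # ks)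
     else if cls k = cls one then (cls one, (\<psi> e \<inter> \<psi> (pl k), snd (hd (nf_steps k ks))) # tl (nf_steps k ks))
     else (cls one, (\<psi> e \<inter> \<psi> (pl k), cls k) # nf_steps k ks))"
proof -
  have v: "P.nf_val (cls k, nf_steps k ks) = \<psi> (pl k)" using nf_val_cnf[OF assms, of ks] by (simp add: cnf_def)
  show ?thesis unfolding cnf_def list.sel P.lact.simps v using nf_steps_ne[of k ks] by simp
qed

text \<open>The three cases mirror those of \<open>lact\<close>: \<open>h \<cdot> k\<close> replaces
  \<open>k\<close> if \<open>pl k\<close> is below \<open>st h\<close>; it also does if
  \<open>k\<close> is a projection; otherwise \<open>h\<close>, cut down to star
  \<open>st h \<cdot> pl k\<close>, becomes a new first factor. The last conjunct records that the
  star of the last factor can only decrease.\<close>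

lemma canonical_mult_H:
  assumes h: "h \<in> H" and c: "canonical_list (k # ks)"
  shows "\<exists>cs. canonical_list cs \<and> lp cs = h \<cdot> lp (k # ks) \<and>
    cnf cs = foldr P.lact (word [h]) (cnf (k # ks)) \<and>
    st (last cs) \<cdot> st (last (k # ks)) = st (last cs)"
proof -
  have k: "k \<in> H" using c by (auto simp: canonical_form_def)
  have hk: "st h \<cdot> pl k \<in> E" using E_mult[OF st_in_E] by blast
  have cap: "\<psi> (st h) \<inter> \<psi> (pl k) = \<psi> (st h \<cdot> pl k)" using psi_mult[OF st_in_E] by simp
  have hkk: "st h \<cdot> pl k \<cdot> pl k = st h \<cdot> pl k" by (simp add: mult_assoc E_idem)
  have hkh: "st h \<cdot> (st h \<cdot> pl k) = st h \<cdot> pl k" by (simp add: mult_assoc[symmetric] E_idem st_in_E)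
  \<comment> \<open>A head with smaller star keeps a list canonical and changes only the first class
    and the first star in the normal form.\<close>
  have replace_head: "canonical_list (m # ks)" "lp (m # ks) = m \<cdot> lp ks"
    "cnf (m # ks) = (cls m, (\<psi> (st m), snd (hd (nf_steps k ks))) # tl (nf_steps k ks))"
    "st (last (m # ks)) \<cdot> st (last (k # ks)) = st (last (m # ks))"
    if m: "m \<in> H" "st m \<cdot> st k = st m" for m
  proof -
    show "lp (m # ks) = m \<cdot> lp ks" by simp
    show "cnf (m # ks) = (cls m, (\<psi> (st m), snd (hd (nf_steps k ks))) # tl (nf_steps k ks))"
      by (cases ks) (auto simp: cnf_def)
    show "st (last (m # ks)) \<cdot> st (last (k # ks)) = st (last (m # ks))"
      using m by (auto simp: E_idem st_in_E)
    show "canonical_list (m # ks)"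
    proof (cases ks)
      case Nil
      then show ?thesis using m by (simp add: canonical_single)
    next
      case (Cons k' ks')
      then have k': "st k \<cdot> pl k' = st k" "st k \<noteq> pl k'" "k' \<notin> E" "canonical_list (k' # ks')"
        using c by (auto simp: canonical_Cons_Cons)
      have "st m \<cdot> pl k' = st m" using m(2) k'(1) by (rule E_le_trans)
      \<comment> \<open>Equality would give \<open>pl k'\<close> below \<open>st k\<close>, which is
        strictly below \<open>pl k'\<close>.\<close>
      moreover have "st m \<noteq> pl k'"
      proof
        assume eq: "st m = pl k'"
        then have "pl k' \<cdot> st k = pl k'" using m by simp
        then have "st k = pl k'" using k'(1) E_comm[OF st_in_E, of "pl k'" k] by simp
        then show False using k' by simp
      qed
      ultimately show ?thesis using k' Cons m by (auto simp: canonical_Cons_Cons)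
    qed
  qed
  have nfs: "nf_steps k ks = (\<psi> (st k), snd (hd (nf_steps k ks))) # tl (nf_steps k ks)"
    by (cases ks) auto
  show ?thesis
  proof (cases "pl k \<cdot> st h = pl k")
    case True
    then have m: "h \<cdot> k \<in> H" "st (h \<cdot> k) = st k" using H_mult[OF h k] by auto
    have "\<psi> (st h) \<inter> \<psi> (pl k) = \<psi> (pl k)"
      using True cap E_comm[OF st_in_E, of "pl k" h] by simp
    then have "foldr P.lact (word [h]) (cnf (k # ks)) = P.lact (Inl (cls h)) (cnf (k # ks))"
      by (simp add: word_simps lact_psi[OF k])
    also have "\<dots> = cnf (h \<cdot> k # ks)"
      using nfs m replace_head(3)[of "h \<cdot> k"] by (simp add: cnf_def Tmult_cls E_idem st_in_E)
    finally show ?thesis using replace_head[of "h \<cdot> k"] m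
      by (intro exI[of _ "h \<cdot> k # ks"]) (simp add: mult_assoc E_idem st_in_E)
  next
    case False
    have ne: "st h \<cdot> pl k \<noteq> pl k" using False E_comm[OF st_in_E, of "pl k" h] by simp
    then have psi_ne: "\<psi> (st h \<cdot> pl k) \<noteq> \<psi> (pl k)" using psi_inj[OF hk] by blast
    show ?thesis
    proof (cases "k \<in> E")
      case True
      then have plk: "pl k = k" and stk: "st k = k" by (rule pl_E, rule st_E)
      have m: "h \<cdot> k \<in> H" "st (h \<cdot> k) = st h \<cdot> k" using H_mult_E[OF h True] by auto
      have le: "st (h \<cdot> k) \<cdot> st k = st (h \<cdot> k)" using hkk m plk stk by simp
      have ck: "cls k = cls one" using True by (rule cls_E)
      have "cls (h \<cdot> k) = cls h" using True by (rule cls_mult_E)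
      then have "foldr P.lact (word [h]) (cnf (k # ks)) = cnf (h \<cdot> k # ks)"
        using psi_ne cap m replace_head(3)[OF m(1) le] plk ck
        by (simp add: word_simps lact_psi[OF k] Tmult_cls one_right)
      then show ?thesis using replace_head[OF m(1) le]
        by (intro exI[of _ "h \<cdot> k # ks"]) (simp add: mult_assoc)
    next
      case kE: False
      \<comment> \<open>The star of \<open>?m\<close> is strictly below \<open>pl k\<close>, and
        \<open>k\<close> is not a projection, so \<open>?m\<close> can precede \<open>k\<close> in a
        canonical form.\<close>
      let ?m = "h \<cdot> (st h \<cdot> pl k)"
      have m: "?m \<in> H" "st ?m = st h \<cdot> pl k" using H_mult_E[OF h hk] hkh by auto
      have "canonical_list (?m # k # ks)"
        using m hkk ne kE c by (simp add: canonical_Cons_Cons)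
      moreover have "lp (?m # k # ks) = h \<cdot> lp (k # ks)"
      proof -
        have "?m \<cdot> (k \<cdot> lp ks) = (h \<cdot> st h) \<cdot> ((pl k \<cdot> k) \<cdot> lp ks)" by (simp only: mult_assoc)
        then show ?thesis by (simp add: st_absorb pl_absorb)
      qed
      moreover have "cnf (?m # k # ks) = foldr P.lact (word [h]) (cnf (k # ks))"
      proof -
        have "P.lact (Inr (\<psi> (st h))) (cnf (k # ks)) = (cls one, (\<psi> (st h \<cdot> pl k), cls k) # nf_steps k ks)"
          unfolding lact_psi[OF k] using psi_ne cap kE H_cls_one_iff[OF k] by simp
        then show ?thesis
          using m cls_mult_E[OF hk, of h] by (simp add: word_simps Tmult_cls one_right cnf_def)
      qed
      ultimately show ?thesis
        by (intro exI[of _ "?m # k # ks"]) (simp add: E_idem st_in_E)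
    qed
  qed
qed

lemma canonical_mult_list:
  assumes "canonical_list ks" "set hs \<subseteq> H"
  shows "\<exists>cs. canonical_list cs \<and> lp cs = lp hs \<cdot> lp ks \<and>
    cnf cs = foldr P.lact (word hs) (cnf ks) \<and> st (last cs) \<cdot> st (last ks) = st (last cs)"
  using assms(2)
proof (induction hs)
  case Nil
  then show ?case using assms(1)
    by (intro exI[of _ ks]) (simp add: word_simps one_left E_idem st_in_E)
next
  case (Cons h hs)
  then obtain cs where cs: "canonical_list cs" "lp cs = lp hs \<cdot> lp ks"
    "cnf cs = foldr P.lact (word hs) (cnf ks)" "st (last cs) \<cdot> st (last ks) = st (last cs)"
    by auto
  obtain k ks' where k: "cs = k # ks'" using cs(1) canonical_Nil by (cases cs) auto
  have h: "h \<in> H" using Cons.prems by simp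
  obtain ds where ds: "canonical_list ds" "lp ds = h \<cdot> lp cs"
    "cnf ds = foldr P.lact (word [h]) (cnf cs)" "st (last ds) \<cdot> st (last cs) = st (last ds)"
    using canonical_mult_H[OF h cs(1)[unfolded k]] unfolding k by blast
  have "st (last ds) \<cdot> st (last ks) = st (last ds)" using ds(4) cs(4) by (rule E_le_trans)
  moreover have "lp ds = lp (h # hs) \<cdot> lp ks" using ds(2) cs(2) by (simp add: mult_assoc)
  moreover have "cnf ds = foldr P.lact (word (h # hs)) (cnf ks)"
    using ds(3) cs(3) by (simp add: word_simps)
  ultimately show ?case using ds(1) by blast
qed

lemma canonical_unique: "canonical_list hs \<Longrightarrow> canonical_list ks \<Longrightarrow> lp hs = lp ks \<Longrightarrow> hs = ks"
  using canonical unfolding has_canonical_forms_def by blast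

section \<open>Canonical forms of elements, with their projections and stars\<close>

definition canon :: "'q \<Rightarrow> 'q list" where
  "canon q = (THE hs. canonical_list hs \<and> lp hs = q)"

lemma canonical_canon: "canonical_list (canon q)" and lp_canon: "lp (canon q) = q"
proof -
  have "\<exists>!hs. canonical_list hs \<and> lp hs = q"
    using canonical by (simp add: has_canonical_forms_def)
  from theI'[OF this] have "canonical_list (canon q) \<and> lp (canon q) = q"
    unfolding canon_def .
  then show "canonical_list (canon q)" "lp (canon q) = q" by auto
qed

lemma canon_eqI: "canonical_list hs \<Longrightarrow> lp hs = q \<Longrightarrow> canon q = hs"
  using canonical_unique canonical_canon lp_canon by metis

lemma canon_H: "h \<in> H \<Longrightarrow> canon h = [h]"
  by (intro canon_eqI) (simp_all add: canonical_single one_right)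

lemma canon_ne: "canon q \<noteq> []"
  using canonical_canon canonical_Nil by metis

lemma canon_subset: "set (canon q) \<subseteq> H"
  using canonical_canon by (auto simp: canonical_form_def)

lemma foldr_lact_cnf_canon:
  "set hs \<subseteq> H \<Longrightarrow> foldr P.lact (word hs) (cnf (canon q)) = cnf (canon (lp hs \<cdot> q))"
  using canonical_mult_list[OF canonical_canon, of hs q] canon_eqI lp_canon by metis

lemma lp_append: "lp (hs @ ks) = lp hs \<cdot> lp ks"
  by (induction hs) (simp_all add: one_left mult_assoc)

text \<open>The last factor alone is a canonical form, so its word has a known normal form; the
  remaining factors act on it from the left.\<close>

lemma nf_word_list:
  assumes "hs \<noteq> []" "set hs \<subseteq> H"
  shows "P.nf (word hs) = cnf (canon (lp hs))"
proof -
  obtain hs' k where hs: "hs = hs' @ [k]" using assms(1) by (cases hs rule: rev_cases) auto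
  have k: "k \<in> H" and hs': "set hs' \<subseteq> H" using assms hs by auto
  have "P.nf (word hs) = foldr P.lact (word hs') (cnf (canon k))"
    using k hs by (simp add: word_append P.nf_append nf_word_single canon_H)
  also have "\<dots> = cnf (canon (lp hs))"
    using foldr_lact_cnf_canon[OF hs'] hs by (simp add: lp_append one_right)
  finally show ?thesis .
qed

lemma nf_word_canon: "P.nf (word (canon q)) = cnf (canon q)"
  using nf_word_list[OF canon_ne canon_subset] lp_canon by simp

text \<open>Since \<open>st h\<close> is below \<open>pl k\<close>, multiplying \<open>h\<close> by
  \<open>pl k\<close> leaves it unchanged.\<close>

lemma pl_lp_canonical: "canonical_list (h # hs) \<Longrightarrow> pl (lp (h # hs)) = pl h"
proof (induction hs arbitrary: h)
  case Nil
  then show ?case by (simp add: one_right)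
next
  case (Cons k ks)
  have c: "canonical_list (k # ks)" and hk: "st h \<cdot> pl k = st h"
    using Cons.prems by (auto simp: canonical_Cons_Cons)
  have "pl (lp (h # k # ks)) = pl (h \<cdot> pl (lp (k # ks)))" using pl_mult[of h "lp (k # ks)"] by simp
  also have "\<dots> = pl (h \<cdot> pl k)" using Cons.IH[OF c] by simp
  also have "h \<cdot> pl k = h \<cdot> st h \<cdot> pl k" by (simp add: st_absorb)
  also have "\<dots> = h" unfolding mult_assoc hk by (rule st_absorb)
  finally show ?case .
qed

lemma pl_eq_hd: "pl q = pl (hd (canon q))"
  using pl_lp_canonical[of "hd (canon q)" "tl (canon q)"] canonical_canon[of q] canon_ne[of q] lp_canon[of q]
  by simp

text \<open>Left multiplication can only lower the star of the last canonical factor, and \<open>q q\<^sup>* = q\<close>.\<close>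

lemma st_eq_last: "st q = st (last (canon q))"
proof -
  let ?l = "st (last (canon q))"
  have "lp hs \<cdot> st (last hs) = lp hs" if "hs \<noteq> []" for hs
    using that by (induction hs) (auto simp: mult_assoc one_right one_left st_absorb)
  then have "q \<cdot> ?l = q" using canon_ne[of q] lp_canon[of q] by metis
  then have "st q \<cdot> ?l = st q" using st_mult_st[of q "last (canon q)"] by simp
  moreover have "?l \<cdot> st q = ?l"
  proof -
    have "canonical_list [st q]" using E_H[OF st_in_E] by (simp add: canonical_single)
    then obtain cs where cs: "canonical_list cs" "lp cs = lp (canon q) \<cdot> lp [st q]"
      "st (last cs) \<cdot> st (last [st q]) = st (last cs)"
      using canonical_mult_list[OF _ canon_subset] by blast
    then have "canon q = cs" by (intro canon_eqI) (simp_all add: lp_canon one_right st_absorb)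
    then show ?thesis using cs(3) by (simp add: st_st)
  qed
  ultimately show ?thesis using E_comm[OF st_in_E st_in_E, of q "last (canon q)"] by simp
qed

lemma nf_steps_last: "\<exists>L. nf_steps h hs = L @ [(\<psi> (st (last (h # hs))), cls one)]"
proof (induction hs arbitrary: h)
  case (Cons k ks)
  then obtain L where "nf_steps k ks = L @ [(\<psi> (st (last (k # ks))), cls one)]" by blast
  then show ?case by (intro exI[of _ "(\<psi> (st h), cls k) # L"]) simp
qed simp

text \<open>Injectivity of \<open>\<psi>\<close> recovers the stars, and properness recovers each
  factor from its class and star.\<close>

lemma nf_steps_inj:
  "set (h # hs) \<subseteq> H \<Longrightarrow> set (k # ks) \<subseteq> H \<Longrightarrow> cls h = cls k \<Longrightarrow> nf_steps h hs = nf_steps k ks \<Longrightarrow>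
   h # hs = k # ks"
proof (induction hs arbitrary: h k ks)
  case Nil
  then have "ks = []" by (cases ks) (auto simp: nf_steps_ne nf_steps_ne[symmetric])
  then show ?case using Nil psi_inj[OF st_in_E st_in_E] H_proper by auto
next
  case (Cons h' hs)
  then obtain k' ks' where ks: "ks = k' # ks'" by (cases ks) (auto simp: nf_steps_ne)
  have "h = k" using Cons.prems ks psi_inj[OF st_in_E st_in_E] H_proper by auto
  moreover have "h' # hs = k' # ks'" using Cons.prems ks by (intro Cons.IH) auto
  ultimately show ?case using ks by simp
qed

section \<open>The isomorphism\<close>

abbreviation Y :: "('q \<times> 'q) set set set" where
  "Y \<equiv> \<psi> ` E"

abbreviation QY :: "('q set + ('q \<times> 'q) set set) list set set" where
  "QY \<equiv> Ql_car T (Tmult mult pl) (cls one) X (\<inter>) points acts Y"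

definition \<phi> :: "'q \<Rightarrow> ('q set + ('q \<times> 'q) set set) list set" where
  "\<phi> q = P.cl (word (canon q))"

lemma word_canon_Words: "word (canon q) \<in> P.W"
  using canon_ne by (rule word_Words)

text \<open>Any factorisation over \<open>H\<close>, canonical or not, represents the image of its
  product; multiplicativity follows by concatenation.\<close>

lemma phi_lp: "hs \<noteq> [] \<Longrightarrow> set hs \<subseteq> H \<Longrightarrow> P.cl (word hs) = \<phi> (lp hs)"
  unfolding \<phi>_def using P.cl_eq_iff[OF word_Words word_canon_Words] nf_word_list nf_word_canon by simp

lemma inj_phi: "inj \<phi>"
proof (rule injI)
  fix a b assume "\<phi> a = \<phi> b"
  then have "cnf (canon a) = cnf (canon b)"
    unfolding \<phi>_def using P.cl_eq_iff[OF word_canon_Words word_canon_Words] nf_word_canon by simp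
  then have "hd (canon a) # tl (canon a) = hd (canon b) # tl (canon b)"
    using canon_subset[of a] canon_subset[of b] canon_ne[of a] canon_ne[of b]
    by (intro nf_steps_inj) (auto simp: cnf_def)
  then have "canon a = canon b" using canon_ne by simp
  then show "a = b" using lp_canon by metis
qed

lemma phi_mult: "\<phi> (a \<cdot> b) = Pl_mult T (Tmult mult pl) (cls one) X (\<inter>) points acts (\<phi> a) (\<phi> b)"
proof -
  have "P.cl (word (canon a @ canon b)) = \<phi> (lp (canon a @ canon b))"
    using canon_subset canon_ne by (intro phi_lp) auto
  then show ?thesis
    unfolding \<phi>_def[of a] \<phi>_def[of b] P.Pl_mult_cl[OF word_canon_Words word_canon_Words]
    by (simp add: word_append lp_append lp_canon)
qed

lemma phi_E:
  assumes "e \<in> E"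
  shows "\<phi> e = P.cl [Inr (\<psi> e)]"
proof -
  have "word (canon e) = [Inl (cls one), Inr (\<psi> e)]"
    unfolding canon_H[OF E_H[OF assms]] word_simps st_E[OF assms] cls_E[OF assms] ..
  moreover have "P.rel [Inl (cls one), Inr (\<psi> e)] [Inr (\<psi> e)]"
    by (rule P.rel_t1_Inr[OF psi_in_X]) simp
  ultimately show ?thesis
    unfolding \<phi>_def P.rel_def by (simp add: equiv_class_eq[OF P.equiv_rel])
qed

lemma phi_pl: "\<phi> (pl q) = Pl_plus T (Tmult mult pl) (cls one) X (\<inter>) points acts (\<phi> q)"
proof -
  have "hd (canon q) \<in> H" using canon_subset canon_ne hd_in_set by blast
  then have "P.nf_val (P.nf (word (canon q))) = \<psi> (pl q)"
    using nf_val_cnf[of "hd (canon q)" "tl (canon q)"] canon_ne[of q]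
    by (simp add: nf_word_canon pl_eq_hd[symmetric])
  then show ?thesis
    unfolding \<phi>_def[of q] P.Pl_plus_cl[OF word_canon_Words] by (simp add: phi_E)
qed

lemma phi_st: "\<phi> (st q) = Pl_star T (Tmult mult pl) (cls one) X (\<inter>) points acts (\<phi> q)"
proof -
  obtain L where L: "nf_steps (hd (canon q)) (tl (canon q)) = L @ [(\<psi> (st q), cls one)]"
    using nf_steps_last[of "hd (canon q)" "tl (canon q)"] canon_ne[of q] by (auto simp: st_eq_last[symmetric])
  then have "P.nf (word (canon q)) = (cls (hd (canon q)), L @ [(\<psi> (st q), cls one)])"
    by (simp add: nf_word_canon cnf_def)
  then show ?thesis
    unfolding \<phi>_def[of q] phi_E[OF st_in_E] using P.Pl_star_cl[OF word_canon_Words] by simp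
qed

text \<open>By \<open>acts_psi\<close> and \<open>acts_psi_imp_H\<close> the generators of
  \<open>QY\<close> are exactly the words of single members of \<open>H\<close>.\<close>

lemma range_phi: "range \<phi> = QY"
proof
  show "range \<phi> \<subseteq> QY"
  proof clarify
    fix q
    let ?ws = "map (\<lambda>h. [Inl (cls h), Inr (\<psi> (st h))]) (canon q)"
    have "\<exists>t\<in>T. \<exists>e\<in>Y. acts t e \<in> Y \<and> w = [Inl t, Inr e]" if w: "w \<in> set ?ws" for w
    proof -
      obtain h where h: "h \<in> H" "w = [Inl (cls h), Inr (\<psi> (st h))]" using w canon_subset[of q] by auto
      moreover have "acts (cls h) (\<psi> (st h)) \<in> Y" using acts_psi[OF h(1)] by simp
      moreover have "\<psi> (st h) \<in> Y" using st_in_E by blast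
      ultimately show ?thesis using Tcar_cls by blast
    qed
    moreover have "?ws \<noteq> []" "\<phi> q = P.cl (concat ?ws)" using canon_ne by (auto simp: \<phi>_def word_def)
    ultimately show "\<phi> q \<in> QY" unfolding Ql_car_def by blast
  qed
  show "QY \<subseteq> range \<phi>"
  proof
    fix A assume "A \<in> QY"
    then obtain ws where ws: "ws \<noteq> []" "A = P.cl (concat ws)"
      "\<forall>w\<in>set ws. \<exists>t\<in>T. \<exists>e\<in>Y. acts t e \<in> Y \<and> w = [Inl t, Inr e]"
      unfolding Ql_car_def by blast
    have "\<exists>h\<in>H. w = [Inl (cls h), Inr (\<psi> (st h))]" if w: "w \<in> set ws" for w
    proof -
      obtain q e f where "e \<in> E" "acts (cls q) (\<psi> e) = \<psi> f" "w = [Inl (cls q), Inr (\<psi> e)]"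
        using ws(3) w unfolding Tcar_cls by blast
      then show ?thesis using acts_psi_imp_H by metis
    qed
    \<comment> \<open>A member of \<open>H\<close> is chosen for each block, so the concatenation
      becomes \<open>word\<close> of a list over \<open>H\<close>.\<close>
    then obtain g where g: "\<And>w. w \<in> set ws \<Longrightarrow> g w \<in> H \<and> w = [Inl (cls (g w)), Inr (\<psi> (st (g w)))]"
      by metis
    have "map (\<lambda>w. [Inl (cls (g w)), Inr (\<psi> (st (g w)))]) ws = ws"
      using g by (intro map_idI) metis
    then have "concat ws = word (map g ws)" by (simp add: word_def comp_def)
    moreover have "set (map g ws) \<subseteq> H" using g by auto
    ultimately have "A = \<phi> (lp (map g ws))" using phi_lp[of "map g ws"] ws by simp
    then show "A \<in> range \<phi>" by blast
  qed
qed

lemma phi_iso: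
  "biunary_monoid_iso mult one pl st QY
     (Pl_mult T (Tmult mult pl) (cls one) X (\<inter>) points acts)
     (Pl_plus T (Tmult mult pl) (cls one) X (\<inter>) points acts)
     (Pl_star T (Tmult mult pl) (cls one) X (\<inter>) points acts) \<phi>"
  unfolding biunary_monoid_iso_def range_phi[symmetric]
  using inj_phi by (auto simp: bij_betw_def phi_mult[symmetric] phi_pl phi_st one_left one_right)

lemma QY_subsemigroup:
  "biunary_monoid_subsemigroup QY
     (Pl_car T (Tmult mult pl) (cls one) X (\<inter>) points acts)
     (Pl_mult T (Tmult mult pl) (cls one) X (\<inter>) points acts)
     (Pl_plus T (Tmult mult pl) (cls one) X (\<inter>) points acts)
     (Pl_star T (Tmult mult pl) (cls one) X (\<inter>) points acts)"
  unfolding biunary_monoid_subsemigroup_def range_phi[symmetric]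
proof (intro conjI)
  show "range \<phi> \<subseteq> Pl_car T (Tmult mult pl) (cls one) X (\<inter>) points acts"
    using P.cl_in_Pl_car[OF word_canon_Words] by (auto simp: \<phi>_def)
qed (auto simp: phi_mult[symmetric] phi_pl[symmetric] phi_st[symmetric] one_left one_right
    intro!: exI[of _ one])

section \<open>The subsemilattice \<open>Y\<close> and conditions (A) and (B)\<close>

lemma Y_subsemilattice: "subsemilattice_with_identity Y X (\<inter>)"
proof -
  have "\<psi> e \<inter> \<psi> f \<in> Y" if "e \<in> E" "f \<in> E" for e f
    using psi_mult[OF that, symmetric] E_mult[OF that] by simp
  moreover have "\<psi> one \<inter> \<psi> e = \<psi> e" if "e \<in> E" for e
    using psi_mult[OF one_in_E that] by (simp add: one_left)
  ultimately show ?thesis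
    unfolding subsemilattice_with_identity_def using psi_in_X
    by (intro conjI bexI[OF _ imageI[OF one_in_E, of \<psi>]]) auto
qed

lemma psi_iso: "bij_betw \<psi> E Y \<and> (\<forall>e\<in>E. \<forall>f\<in>E. \<psi> (e \<cdot> f) = \<psi> e \<inter> \<psi> f)"
  using psi_inj psi_mult by (auto intro!: inj_on_imp_bij_betw inj_onI)

text \<open>Where \<open>acts t (\<psi> f)\<close> lies in \<open>Y\<close>, some \<open>h\<close>
  in \<open>H\<close> has class \<open>t\<close> and star \<open>f\<close>; by (H2),
  \<open>h \<cdot> e\<close> serves for any \<open>e\<close> below \<open>f\<close>.\<close>

lemma Y_condA: "condA T Y (\<inter>) acts"
  unfolding condA_def leX_def
proof (intro ballI impI)
  fix t x y assume "t \<in> T" "x \<in> Y" "y \<in> Y" and xy: "x \<inter> y = x \<and> acts t y \<in> Y"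
  then obtain q e f g where *: "t = cls q" "e \<in> E" "x = \<psi> e" "f \<in> E" "y = \<psi> f" "acts t y = \<psi> g"
    unfolding Tcar_cls by blast
  then obtain h where h: "h \<in> H" "cls h = cls q" "st h = f" using acts_psi_imp_H by metis
  have ef: "e \<cdot> f = e" using xy * psi_le_iff by blast
  have "st (h \<cdot> e) = e" "h \<cdot> e \<in> H"
    using H_mult_E[OF h(1) *(2)] h(3) ef E_comm[OF *(2,4)] by auto
  moreover have "cls (h \<cdot> e) = cls q" using cls_mult_E[OF *(2)] h(2) by simp
  ultimately have "acts (cls q) (\<psi> e) = \<psi> (pl (h \<cdot> e))" using acts_psi[of "h \<cdot> e"] by simp
  then show "acts t x \<in> Y" using * by simp
qed

text \<open>By (H4) every class meets \<open>H\<close>, and the star of such an element gives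
  \<open>g\<close>.\<close>

lemma Y_condB: "condB T Y acts"
  unfolding condB_def Tcar_cls
proof clarify
  fix q
  obtain h where h: "h \<in> H" "cls h = cls q" using H_dense by blast
  then have "acts (cls q) (\<psi> (st h)) \<in> Y" using acts_psi[OF h(1)] by simp
  then show "\<exists>g\<in>Y. acts (cls q) g \<in> Y" using st_in_E by blast
qed

end

theorem mainTheorem20:
  fixes mult :: "'q \<Rightarrow> 'q \<Rightarrow> 'q" and one :: 'q and pl st :: "'q \<Rightarrow> 'q" and H :: "'q set"
  assumes "star_left_ehresmann mult one pl st"
      and "proper_basis mult one pl st H"
  shows "\<exists>(Xc :: ('q \<times> 'q) set set set) meet oneX
            (act :: 'q set \<Rightarrow> ('q \<times> 'q) set set \<Rightarrow> ('q \<times> 'q) set set) Yc.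
     semilattice_with_identity Xc meet oneX \<and>
     order_preserving_left_action (Tcar mult pl) (Tmult mult pl) (Tone mult one pl) Xc meet act \<and>
     subsemilattice_with_identity Yc Xc meet \<and>
     (\<exists>\<psi>. bij_betw \<psi> (range pl) Yc \<and>
          (\<forall>e\<in>range pl. \<forall>f\<in>range pl. \<psi> (mult e f) = meet (\<psi> e) (\<psi> f))) \<and>
     condA (Tcar mult pl) Yc meet act \<and>
     condB (Tcar mult pl) Yc act \<and>
     biunary_monoid_subsemigroup
        (Ql_car (Tcar mult pl) (Tmult mult pl) (Tone mult one pl) Xc meet oneX act Yc)
        (Pl_car (Tcar mult pl) (Tmult mult pl) (Tone mult one pl) Xc meet oneX act)
        (Pl_mult (Tcar mult pl) (Tmult mult pl) (Tone mult one pl) Xc meet oneX act)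
        (Pl_plus (Tcar mult pl) (Tmult mult pl) (Tone mult one pl) Xc meet oneX act)
        (Pl_star (Tcar mult pl) (Tmult mult pl) (Tone mult one pl) Xc meet oneX act) \<and>
     (\<exists>\<phi>. biunary_monoid_iso mult one pl st
        (Ql_car (Tcar mult pl) (Tmult mult pl) (Tone mult one pl) Xc meet oneX act Yc)
        (Pl_mult (Tcar mult pl) (Tmult mult pl) (Tone mult one pl) Xc meet oneX act)
        (Pl_plus (Tcar mult pl) (Tmult mult pl) (Tone mult one pl) Xc meet oneX act)
        (Pl_star (Tcar mult pl) (Tmult mult pl) (Tone mult one pl) Xc meet oneX act) \<phi>)"
proof -
  interpret proper_basis_monoid mult one pl st H
    using assms by unfold_locales
  show ?thesis
    unfolding Tone_cls
    by (rule exI[of _ X], rule exI[of _ "(\<inter>)"], rule exI[of _ points], rule exI[of _ acts], rule exI[of _ Y])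
      (intro conjI exI[of _ \<psi>] exI[of _ \<phi>] X_semilattice acts_action Y_subsemilattice
        psi_iso[THEN conjunct1] psi_iso[THEN conjunct2] Y_condA Y_condB QY_subsemigroup phi_iso)
qed

end
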